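(* Let $d\ge2$. The set $\mathcal{F}(\mathcal{P}^d_s)\subset\mathbb{Z}^d$ of $f$-vectors of the simplicial $d$-polytopes with the operation $x\boxplus' y:=x+y-(f(\Delta_{d-1}),2)$ forms an affine semigroup, where the modified addition can be realized by glueing in simplex facets.
   Context: A $d$-polytope is a $d$-dimensional convex polytope; it is simplicial if all its facets are simplices. $f(P)=(f_0(P),\dots,f_{d-1}(P))$, where $f_i(P)$ is the number of $i$-dimensional faces. $(f(\Delta_{d-1}),2)\in\mathbb{Z}^d$ is the vector $\big(\binom{d}{1},\binom{d}{2},\dots,\binom{d}{d-1},2\big)$, obtained by appending $2$ to the $f$-vector of the $(d-1)$-simplex. An affine semigroup is a structure isomorphic to a subset of some $\mathbb{Z}^n$ closed under addition. Glueing in simplex facets: given $d$-polytopes $P,Q$ with simplex facets $F\subset P$ and $F'\subset Q$, choose a suitable projective transformation $\pi$ (not sending any point of $P$ to infinity) such that $\pi(P)\cap Q=\pi(F)=F'$, the union $R:=\pi(P)\cup Q$ is a convex polytope, and all proper faces of $\pi(F)=F'$ are also faces of $R$; $R$ is the result of the glueing. That the addition is realized by this glueing means that for simplicial $d$-polytopes $P,Q$ the result $R$ is a simplicial $d$-polytope with $f(R)=f(P)\boxplus' f(Q)$. *)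

theory Defs
  imports "HOL-Analysis.Analysis"
begin

text \<open>The lattice \<open>\<int>\<^sup>n\<close>, as the integer sequences vanishing from index \<open>n\<close> on; this allows \<open>n\<close>
  to be quantified inside a formula.\<close>

definition int_lattice :: "nat \<Rightarrow> (nat \<Rightarrow> int) set" where
  "int_lattice n = {x. \<forall>i\<ge>n. x i = 0}"

definition affine_semigroup :: "'b set \<Rightarrow> ('b \<Rightarrow> 'b \<Rightarrow> 'b) \<Rightarrow> bool" where
  "affine_semigroup S opr \<longleftrightarrow>
     (\<forall>x\<in>S. \<forall>y\<in>S. opr x y \<in> S) \<and>
     (\<exists>n T \<phi>. T \<subseteq> int_lattice n \<and> (\<forall>u\<in>T. \<forall>v\<in>T. (\<lambda>i. u i + v i) \<in> T) \<and>
        bij_betw \<phi> S T \<and> (\<forall>x\<in>S. \<forall>y\<in>S. \<phi> (opr x y) = (\<lambda>i. \<phi> x i + \<phi> y i)))"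

text \<open>A \<open>d\<close>-polytope may lie in any Euclidean space of dimension at least \<open>d\<close>.\<close>

definition simplicial_polytope :: "nat \<Rightarrow> 'a::euclidean_space set \<Rightarrow> bool" where
  "simplicial_polytope d P \<longleftrightarrow>
     polytope P \<and> aff_dim P = int d \<and> (\<forall>F. F facet_of P \<longrightarrow> (int d - 1) simplex F)"

definition f_vector :: "nat \<Rightarrow> 'a::euclidean_space set \<Rightarrow> nat \<Rightarrow> int" where
  "f_vector d P = (\<lambda>i. if i < d then int (card {G. G face_of P \<and> aff_dim G = int i}) else 0)"

definition simplicial_f_vectors :: "'a::euclidean_space itself \<Rightarrow> nat \<Rightarrow> (nat \<Rightarrow> int) set" where
  "simplicial_f_vectors TYPE('a) d = {f_vector d P | P :: 'a set. simplicial_polytope d P}"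

lemma simplicial_f_vectors_subset: "simplicial_f_vectors TYPE('a::euclidean_space) d \<subseteq> int_lattice d"
  by (auto simp: simplicial_f_vectors_def int_lattice_def f_vector_def)

text \<open>The vector \<open>(f(\<Delta>\<^bsub>d-1\<^esub>), 2)\<close> for \<open>d \<ge> 1\<close>: the \<open>(d-1)\<close>-simplex has \<open>d choose (i+1)\<close> faces of
  dimension \<open>i\<close>, and the last entry \<open>1\<close> for \<open>i = d-1\<close> is not part of its \<open>f\<close>-vector.\<close>

definition simplex_f_vector_2 :: "nat \<Rightarrow> nat \<Rightarrow> int" where
  "simplex_f_vector_2 d =
     (\<lambda>i. if i < d - 1 then int (d choose (i + 1)) else if i = d - 1 then 2 else 0)"

definition modified_plus :: "nat \<Rightarrow> (nat \<Rightarrow> int) \<Rightarrow> (nat \<Rightarrow> int) \<Rightarrow> nat \<Rightarrow> int" where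
  "modified_plus d x y = (\<lambda>i. x i + y i - simplex_f_vector_2 d i)"

text \<open>A projective transformation is given by a linear automorphism \<open>L\<close> of the space of homogeneous
  coordinates \<open>'a \<times> real\<close>, a point \<open>x\<close> having coordinates \<open>(x, 1)\<close>; \<open>L\<close> sends \<open>x\<close> to infinity iff
  the last coordinate of the image vanishes.\<close>

definition projective_transformation :: "('a::euclidean_space \<times> real \<Rightarrow> 'a \<times> real) \<Rightarrow> bool" where
  "projective_transformation L \<longleftrightarrow> linear L \<and> bij L"

definition sent_to_infinity :: "('a::euclidean_space \<times> real \<Rightarrow> 'a \<times> real) \<Rightarrow> 'a \<Rightarrow> bool" where
  "sent_to_infinity L x \<longleftrightarrow> snd (L (x, 1)) = 0"

definition proj_map :: "('a::euclidean_space \<times> real \<Rightarrow> 'a \<times> real) \<Rightarrow> 'a \<Rightarrow> 'a" where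
  "proj_map L x = (1 / snd (L (x, 1))) *\<^sub>R fst (L (x, 1))"

text \<open>\<open>R\<close> is the result of glueing the \<open>d\<close>-polytopes \<open>P\<close> and \<open>Q\<close> in their simplex facets \<open>F\<close> and
  \<open>F'\<close> by means of the projective transformation \<open>L\<close>.\<close>

definition glueing ::
  "nat \<Rightarrow> ('a::euclidean_space \<times> real \<Rightarrow> 'a \<times> real) \<Rightarrow>
   'a set \<Rightarrow> 'a set \<Rightarrow> 'a set \<Rightarrow> 'a set \<Rightarrow> 'a set \<Rightarrow> bool" where
  "glueing d L P F Q F' R \<longleftrightarrow>
     polytope P \<and> aff_dim P = int d \<and> F facet_of P \<and> (int d - 1) simplex F \<and>
     polytope Q \<and> aff_dim Q = int d \<and> F' facet_of Q \<and> (int d - 1) simplex F' \<and>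
     projective_transformation L \<and> (\<forall>x\<in>P. \<not> sent_to_infinity L x) \<and>
     proj_map L ` P \<inter> Q = proj_map L ` F \<and> proj_map L ` F = F' \<and>
     R = proj_map L ` P \<union> Q \<and> polytope R \<and>
     (\<forall>G. G face_of F' \<and> G \<noteq> F' \<longrightarrow> G face_of R)"

end

theory Submission
  imports Defs
begin

text \<open>
  An admissible projective transformation maps open segments onto open segments, so it preserves
  faces and their dimensions.  If \<open>P \<inter> Q\<close> is a common facet of \<open>P\<close> and \<open>Q\<close> with convex union, a
  segment from \<open>P - Q\<close> to \<open>Q - P\<close> crosses this facet; therefore the proper faces of \<open>P \<union> Q\<close> are
  those of \<open>P\<close> and of \<open>Q\<close> except the facet itself, and the two families share exactly the proper
  faces of the facet.  For a simplex facet, counting gives the modified addition.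

  For the existence of a glueing, choose a point \<open>a\<close> beyond the facet \<open>F'\<close> of \<open>Q\<close> and beneath all
  others.  The pyramid \<open>T\<close> over \<open>F'\<close> with apex \<open>a\<close> can be glued to \<open>Q\<close>, and hence so can every
  polytope inside \<open>T\<close> that has \<open>F'\<close> as a facet.  Homogeneous coordinates allow the points of \<open>P\<close> off
  the facet \<open>F\<close> to be pushed towards the barycentre of \<open>F\<close>, which moves \<open>P\<close> into such a pyramid.
\<close>

section \<open>Projective transformations\<close>

lemma affine_lift_combination:
  assumes "linear L"
  shows "L ((1 - u) *\<^sub>R x + u *\<^sub>R y, 1::real) = (1 - u) *\<^sub>R L (x, 1) + u *\<^sub>R L (y, 1)"
proof -
  have "((1 - u) *\<^sub>R x + u *\<^sub>R y, 1) = (1 - u) *\<^sub>R (x, 1::real) + u *\<^sub>R (y, 1)"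
    by simp
  then show ?thesis
    by (simp only: linear_add[OF assms] linear_scale[OF assms])
qed

lemma lift_proj_map:
  assumes "snd (L (x, 1)) \<noteq> 0"
  shows "L (x, 1) = snd (L (x, 1)) *\<^sub>R (proj_map L x, 1)"
  using assms by (simp add: proj_map_def prod_eq_iff)

lemma proj_map_unique:
  assumes "L (x, 1) = c *\<^sub>R (y, 1)" "c \<noteq> 0"
  shows "proj_map L x = y"
  using assms by (simp add: proj_map_def)

lemma inj_on_proj_map:
  assumes "linear L" "inj L" "\<And>x. x \<in> S \<Longrightarrow> snd (L (x, 1)) \<noteq> 0"
  shows "inj_on (proj_map L) S"
proof (rule inj_onI)
  fix x y assume xy: "x \<in> S" "y \<in> S" "proj_map L x = proj_map L y"
  define c where "c = snd (L (x, 1)) / snd (L (y, 1))"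
  have "L (x, 1) = snd (L (x, 1)) *\<^sub>R (proj_map L y, 1)"
    using lift_proj_map assms(3) xy by metis
  also have "\<dots> = c *\<^sub>R L (y, 1)"
    using lift_proj_map[of L y] assms(3)[OF xy(2)] unfolding c_def
    by (smt (verit) nonzero_mult_div_cancel_left scaleR_scaleR times_divide_eq_left mult.commute)
  also have "\<dots> = L (c *\<^sub>R (y, 1))"
    using linear_scale[OF assms(1)] by metis
  finally have "(x, 1::real) = c *\<^sub>R (y, 1)"
    using \<open>inj L\<close> by (meson injD)
  then show "x = y" by simp
qed

text \<open>In homogeneous coordinates a convex combination of the end points stays a nonnegative
  combination. Division by the last coordinate replaces the parameter \<open>u\<close> by
  \<open>t u\<close>, which runs through the whole unit interval because both end points have
  positive last coordinate.\<close>

lemma proj_map_closed_segment: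
  assumes L: "linear L" and pos: "snd (L (x, 1)) > 0" "snd (L (y, 1)) > 0"
  shows "proj_map L ` closed_segment x y = closed_segment (proj_map L x) (proj_map L y)"
proof -
  define a b where "a = snd (L (x, 1))" and "b = snd (L (y, 1))"
  define t where "t u = u * b / ((1 - u) * a + u * b)" for u
  have ab: "a > 0" "b > 0"
    using pos by (auto simp: a_def b_def)
  have den: "(1 - u) * a + u * b > 0" if "0 \<le> u" "u \<le> 1" for u
    using ab that by (smt (verit) mult_nonneg_nonneg mult_pos_pos)
  have eq: "proj_map L ((1 - u) *\<^sub>R x + u *\<^sub>R y) = (1 - t u) *\<^sub>R proj_map L x + t u *\<^sub>R proj_map L y"
    if u: "0 \<le> u" "u \<le> 1" for u
  proof (rule proj_map_unique)
    let ?D = "(1 - u) * a + u * b"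
    have "?D * (1 - t u) = (1 - u) * a" "?D * t u = u * b"
      using den[OF u] by (auto simp: t_def field_simps)
    then have "?D *\<^sub>R ((1 - t u) *\<^sub>R (proj_map L x, 1) + t u *\<^sub>R (proj_map L y, 1))
        = ((1 - u) * a) *\<^sub>R (proj_map L x, 1) + (u * b) *\<^sub>R (proj_map L y, 1)"
      by (simp only: scaleR_add_right scaleR_scaleR)
    also have "\<dots> = (1 - u) *\<^sub>R L (x, 1) + u *\<^sub>R L (y, 1)"
      using lift_proj_map[of L x] lift_proj_map[of L y] pos
      by (metis a_def b_def less_irrefl scaleR_scaleR)
    finally show "L ((1 - u) *\<^sub>R x + u *\<^sub>R y, 1)
        = ?D *\<^sub>R ((1 - t u) *\<^sub>R proj_map L x + t u *\<^sub>R proj_map L y, 1)"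
      by (simp add: affine_lift_combination[OF L])
    show "?D \<noteq> 0" using den[OF u] by simp
  qed
  have t01: "0 \<le> t u" "t u \<le> 1" if "0 \<le> u" "u \<le> 1" for u
    using den[OF that] that ab by (auto simp: t_def divide_simps)
  have surj: "\<exists>u. 0 \<le> u \<and> u \<le> 1 \<and> t u = s" if s: "0 \<le> s" "s \<le> 1" for s
  proof -
    \<comment> \<open>Solving \<open>t u = s\<close> for \<open>u\<close> gives
      \<open>s * a / D\<close>; this is \<open>t\<close> with the weights \<open>a\<close> and
      \<open>b\<close> interchanged.\<close>
    define D where "D = (1 - s) * b + s * a"
    have D: "D > 0"
      using ab s unfolding D_def by (smt (verit) mult_nonneg_nonneg mult_pos_pos)
    let ?u = "s * a / D"
    have "1 - ?u = (1 - s) * b / D"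
      using D by (simp add: D_def field_simps)
    then have "(1 - ?u) * a + ?u * b = a * b / D"
      using D by (simp add: field_simps) (simp add: D_def algebra_simps)
    then have "t ?u = s"
      using ab D by (simp add: t_def)
    moreover have "0 \<le> ?u" "?u \<le> 1"
      using ab s D by (auto simp: D_def divide_simps)
    ultimately show ?thesis by blast
  qed
  show ?thesis
  proof (intro equalityI subsetI)
    fix z assume "z \<in> proj_map L ` closed_segment x y"
    then show "z \<in> closed_segment (proj_map L x) (proj_map L y)"
      using eq t01 by (fastforce simp: in_segment)
  next
    fix z assume "z \<in> closed_segment (proj_map L x) (proj_map L y)"
    then obtain s where s: "0 \<le> s" "s \<le> 1" "z = (1 - s) *\<^sub>R proj_map L x + s *\<^sub>R proj_map L y"
      by (auto simp: in_segment)
    with surj obtain u where "0 \<le> u" "u \<le> 1" "t u = s" by blast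
    with s eq[of u] have "z = proj_map L ((1 - u) *\<^sub>R x + u *\<^sub>R y)"
      "(1 - u) *\<^sub>R x + u *\<^sub>R y \<in> closed_segment x y"
      by (auto simp: in_segment)
    then show "z \<in> proj_map L ` closed_segment x y" by blast
  qed
qed

text \<open>The lifted points lie on an affine hyperplane that misses the origin, so adjoining 0
  raises the affine dimension by one; after that, affine and linear dimension agree. This turns
  affine dimensions into linear ones, on which \<open>L\<close> acts linearly.\<close>

lemma aff_dim_homogenize:
  fixes S :: "'a::euclidean_space set"
  shows "int (dim ((\<lambda>x. (x, 1::real)) ` S)) = aff_dim S + 1"
proof -
  let ?h = "\<lambda>x::'a. (x, 1::real)"
  have "?h ` S = (+) (0, 1) ` (\<lambda>x. (x, 0)) ` S"
    by force
  moreover have "linear (\<lambda>x::'a. (x, 0::real))" "inj (\<lambda>x::'a. (x, 0::real))"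
    by (auto intro!: linearI simp: inj_def)
  ultimately have 1: "aff_dim (?h ` S) = aff_dim S"
    by (simp add: aff_dim_translation_eq)
  have "?h ` S \<subseteq> {z. (0, 1) \<bullet> z = 1}"
    by auto
  then have "affine hull (?h ` S) \<subseteq> {z. (0, 1) \<bullet> z = 1}"
    by (intro hull_minimal affine_hyperplane)
  then have 0: "0 \<notin> affine hull (?h ` S)"
    by auto
  have "int (dim (?h ` S)) = int (dim (insert 0 (?h ` S)))"
    by (metis dim_span span_insert_0)
  also have "\<dots> = aff_dim (insert 0 (?h ` S))"
    by (metis aff_dim_zero hull_inc insertI1)
  finally show ?thesis
    using 0 1 by (simp add: aff_dim_insert)
qed

text \<open>The lift of \<open>proj_map L x\<close> and the vector \<open>L (x, 1)\<close> differ by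
  a nonzero factor, so both families span the same subspace, and an injective \<open>L\<close> keeps
  its dimension.\<close>

lemma aff_dim_proj_map:
  fixes S :: "'a::euclidean_space set"
  assumes L: "linear L" "inj L" and nz: "\<And>x. x \<in> S \<Longrightarrow> snd (L (x, 1)) \<noteq> 0"
  shows "aff_dim (proj_map L ` S) = aff_dim S"
proof -
  let ?h = "\<lambda>x::'a. (x, 1::real)"
  have "span (?h ` proj_map L ` S) = span (L ` ?h ` S)"
  proof (intro subset_antisym span_minimal subspace_span subsetI)
    fix z assume "z \<in> ?h ` proj_map L ` S"
    then obtain x where x: "x \<in> S" "z = (proj_map L x, 1)" by auto
    then have "z = (1 / snd (L (x, 1))) *\<^sub>R L (x, 1)"
      using nz[OF x(1)] by (simp add: proj_map_def prod_eq_iff)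
    moreover have "L (x, 1) \<in> L ` ?h ` S" using x by auto
    ultimately show "z \<in> span (L ` ?h ` S)"
      by (simp add: span_base span_mul)
  next
    fix z assume "z \<in> L ` ?h ` S"
    then obtain x where x: "x \<in> S" "z = L (x, 1)" by auto
    then have "z = snd (L (x, 1)) *\<^sub>R (proj_map L x, 1)"
      using lift_proj_map nz by blast
    moreover have "(proj_map L x, 1) \<in> ?h ` proj_map L ` S" using x by auto
    ultimately show "z \<in> span (?h ` proj_map L ` S)"
      by (metis span_base span_mul)
  qed
  then have "dim (?h ` proj_map L ` S) = dim (L ` ?h ` S)"
    by (metis dim_span)
  also have "\<dots> = dim (?h ` S)"
    using L by (metis dim_image_eq inj_on_subset subset_UNIV)
  finally show ?thesis
    using aff_dim_homogenize[of S] aff_dim_homogenize[of "proj_map L ` S"] by simp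
qed

lemma proj_map_open_segment:
  assumes L: "linear L" "inj L" and pos: "snd (L (x, 1)) > 0" "snd (L (y, 1)) > 0"
  shows "proj_map L ` open_segment x y = open_segment (proj_map L x) (proj_map L y)"
proof -
  have "snd (L (z, 1)) \<noteq> 0" if z: "z \<in> closed_segment x y" for z
  proof -
    obtain u where "0 \<le> u" "u \<le> 1" "z = (1 - u) *\<^sub>R x + u *\<^sub>R y"
      using z by (auto simp: in_segment)
    then have "snd (L (z, 1)) = (1 - u) * snd (L (x, 1)) + u * snd (L (y, 1))" "0 \<le> u" "u \<le> 1"
      by (auto simp: affine_lift_combination[OF L(1)])
    then show ?thesis
      using pos by (smt (verit) mult_nonneg_nonneg mult_pos_pos)
  qed
  then have "inj_on (proj_map L) (closed_segment x y)"
    using inj_on_proj_map[OF L] by blast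
  then show ?thesis
    unfolding open_segment_def
    by (subst inj_on_image_set_diff[where C = "closed_segment x y"])
      (auto simp: proj_map_closed_segment[OF L(1) pos])
qed

text \<open>The last coordinate is affine along segments, so without zeros on a convex set it has
  constant sign. If the sign is negative, the negated linear map induces the same projective
  map.\<close>

lemma admissible_projective_transformation_pos:
  fixes P :: "'a::euclidean_space set"
  assumes L: "projective_transformation L" and P: "convex P"
    and nz: "\<forall>x\<in>P. \<not> sent_to_infinity L x"
  obtains L' where "linear L'" "inj L'" "\<And>x. x \<in> P \<Longrightarrow> snd (L' (x, 1)) > 0" "proj_map L' = proj_map L"
proof (cases "\<exists>y\<in>P. snd (L (y, 1)) < 0")
  case False
  then show ?thesis
    using that[of L] L nz
    by (metis bij_is_inj linorder_neqE_linordered_idom projective_transformation_def sent_to_infinity_def)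
next
  case True
  then obtain y where y: "y \<in> P" "snd (L (y, 1)) < 0" by blast
  have lin: "linear L" and inj: "inj L"
    using L by (auto simp: projective_transformation_def bij_is_inj)
  have neg: "snd (L (x, 1)) < 0" if x: "x \<in> P" for x
  proof (rule ccontr)
    assume "\<not> ?thesis"
    with nz x have px: "snd (L (x, 1)) > 0"
      by (force simp: sent_to_infinity_def)
    \<comment> \<open>The zero of the affine function that interpolates the two last coordinates of
      opposite sign.\<close>
    define u where "u = snd (L (x, 1)) / (snd (L (x, 1)) - snd (L (y, 1)))"
    let ?z = "(1 - u) *\<^sub>R x + u *\<^sub>R y"
    have "0 \<le> u" "u \<le> 1"
      using px y by (auto simp: u_def field_simps)
    then have "?z \<in> P"
      using P x y by (auto intro: convexD_alt)
    moreover have "snd (L (?z, 1)) = 0"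
      using px y(2) by (subst affine_lift_combination[OF lin]) (simp add: u_def field_simps)
    ultimately show False
      using nz by (simp add: sent_to_infinity_def)
  qed
  show ?thesis
  proof (rule that[of "\<lambda>z. - L z"])
    show "linear (\<lambda>z. - L z)"
      using lin by (rule linear_compose_neg)
    show "inj (\<lambda>z. - L z)"
      using inj by (simp add: inj_def)
    show "proj_map (\<lambda>z. - L z) = proj_map L"
      by (auto simp: proj_map_def fun_eq_iff)
  qed (use neg in auto)
qed

section \<open>Faces and convex hulls under maps that preserve segments\<close>

text \<open>Both conditions in the definition of a face, convexity and absorption of end points, can
  be phrased with open segments alone, and \<open>f\<close> carries these over bijectively.\<close>

lemma face_of_image_iff:
  assumes P: "convex P" and inj: "inj_on f P" and G: "G \<subseteq> P"
    and seg: "\<And>x y. x \<in> P \<Longrightarrow> y \<in> P \<Longrightarrow> f ` open_segment x y = open_segment (f x) (f y)"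
  shows "f ` G face_of f ` P \<longleftrightarrow> G face_of P"
proof -
  have os: "open_segment x y \<subseteq> P" if "x \<in> P" "y \<in> P" for x y
    using that P by (simp add: convex_contains_open_segment)
  have seg_G: "open_segment (f x) (f y) \<subseteq> f ` G \<longleftrightarrow> open_segment x y \<subseteq> G" if "x \<in> G" "y \<in> G" for x y
  proof -
    have "x \<in> P" "y \<in> P" using that G by auto
    then show ?thesis
      using inj_on_image_subset_iff[OF inj os G] by (simp flip: seg)
  qed
  have "convex (f ` G) \<longleftrightarrow> (\<forall>x\<in>G. \<forall>y\<in>G. open_segment (f x) (f y) \<subseteq> f ` G)"
    by (simp add: convex_contains_open_segment)
  also have "\<dots> \<longleftrightarrow> (\<forall>x\<in>G. \<forall>y\<in>G. open_segment x y \<subseteq> G)"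
    by (simp add: seg_G)
  finally have cvx: "convex (f ` G) \<longleftrightarrow> convex G"
    by (simp add: convex_contains_open_segment)
  show ?thesis
    unfolding face_of_def cvx
  proof (intro iffI conjI ballI impI; elim conjE)
    fix a b x
    assume *: "\<forall>a\<in>f ` P. \<forall>b\<in>f ` P. \<forall>x\<in>f ` G. x \<in> open_segment a b \<longrightarrow> a \<in> f ` G \<and> b \<in> f ` G"
      and abx: "a \<in> P" "b \<in> P" "x \<in> G" "x \<in> open_segment a b"
    then have "f a \<in> f ` G \<and> f b \<in> f ` G"
      by (metis image_eqI seg)
    then show "a \<in> G" "b \<in> G"
      using abx G inj by (meson inj_on_image_mem_iff)+
  next
    fix a b x
    assume *: "\<forall>a\<in>P. \<forall>b\<in>P. \<forall>x\<in>G. x \<in> open_segment a b \<longrightarrow> a \<in> G \<and> b \<in> G"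
      and abx: "a \<in> f ` P" "b \<in> f ` P" "x \<in> f ` G" "x \<in> open_segment a b"
    then obtain a' b' x' where "a = f a'" "b = f b'" "x = f x'" "a' \<in> P" "b' \<in> P" "x' \<in> G"
      by blast
    moreover from this abx have "x' \<in> open_segment a' b'"
      using seg os G inj by (metis inj_on_image_mem_iff subsetD)
    ultimately show "a \<in> f ` G" "b \<in> f ` G"
      using * by blast+
  qed (use G in auto)
qed

lemma convex_hull_image_segments:
  assumes seg: "\<And>x y. x \<in> convex hull V \<Longrightarrow> y \<in> convex hull V \<Longrightarrow>
      f ` closed_segment x y = closed_segment (f x) (f y)"
  shows "f ` (convex hull V) = convex hull (f ` V)"
proof
  have "convex (f ` (convex hull V))"
  proof (rule convex_contains_segment[THEN iffD2], intro ballI)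
    fix a b assume "a \<in> f ` (convex hull V)" "b \<in> f ` (convex hull V)"
    then obtain x y where "a = f x" "b = f y" "x \<in> convex hull V" "y \<in> convex hull V"
      by blast
    then show "closed_segment a b \<subseteq> f ` (convex hull V)"
      using seg[of x y] by (metis closed_segment_subset convex_convex_hull image_mono)
  qed
  then show "convex hull (f ` V) \<subseteq> f ` (convex hull V)"
    by (simp add: hull_minimal hull_subset image_mono)
  \<comment> \<open>For the other inclusion, the points with image in the target hull form a convex
    set that contains \<open>V\<close>.\<close>
  let ?S = "{x \<in> convex hull V. f x \<in> convex hull (f ` V)}"
  have "convex ?S"
  proof (rule convex_contains_segment[THEN iffD2], intro ballI subsetI)
    fix x y z assume xy: "x \<in> ?S" "y \<in> ?S" "z \<in> closed_segment x y"
    then have "f z \<in> closed_segment (f x) (f y)"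
      using seg by blast
    with xy show "z \<in> ?S"
      by (auto intro: closed_segment_subset[THEN subsetD])
  qed
  moreover have "V \<subseteq> ?S"
    by (auto intro: hull_inc)
  ultimately have "convex hull V \<subseteq> ?S"
    by (rule hull_minimal[rotated])
  then show "f ` (convex hull V) \<subseteq> convex hull (f ` V)"
    by auto
qed

section \<open>Polytopes and their faces under an admissible transformation\<close>

text \<open>Positive last coordinates on \<open>P\<close> are the normalised form of admissibility
  provided by \<open>admissible_projective_transformation_pos\<close>; the results on segments ask
  for exactly this.\<close>

locale admissible_proj =
  fixes L :: "'a::euclidean_space \<times> real \<Rightarrow> 'a \<times> real" and P :: "'a set"
  assumes linear: "linear L" and inj: "inj L" and convex: "convex P"
    and pos: "\<And>x. x \<in> P \<Longrightarrow> snd (L (x, 1)) > 0"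
begin

lemma inj_on: "S \<subseteq> P \<Longrightarrow> inj_on (proj_map L) S"
  by (rule inj_on_proj_map[OF linear inj]) (use pos in force)

lemma aff_dim_image: "S \<subseteq> P \<Longrightarrow> aff_dim (proj_map L ` S) = aff_dim S"
  by (rule aff_dim_proj_map[OF linear inj]) (use pos in force)

lemma face_of_image: "G \<subseteq> P \<Longrightarrow> proj_map L ` G face_of proj_map L ` P \<longleftrightarrow> G face_of P"
  by (rule face_of_image_iff)
    (auto simp: convex inj_on proj_map_open_segment linear inj pos)

lemma convex_hull_image:
  assumes "convex hull V \<subseteq> P"
  shows "proj_map L ` (convex hull V) = convex hull (proj_map L ` V)"
  by (rule convex_hull_image_segments)
    (use assms in \<open>auto simp: proj_map_closed_segment linear inj pos subset_iff\<close>)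

text \<open>Affine independence of the vertices is determined by their number and their affine
  dimension, and both survive the transformation.\<close>

lemma simplex_image:
  assumes "n simplex S" "S \<subseteq> P"
  shows "n simplex (proj_map L ` S)"
proof -
  obtain V where V: "finite V" "\<not> affine_dependent V" "int (card V) = n + 1" "S = convex hull V"
    using assms(1) by (auto simp: simplex)
  then have VP: "V \<subseteq> P"
    using assms(2) hull_subset[of V convex] by simp
  then have "card (proj_map L ` V) = card V" "aff_dim (proj_map L ` V) = aff_dim V"
    by (auto simp: card_image inj_on aff_dim_image)
  with V have "\<not> affine_dependent (proj_map L ` V)"
    by (simp add: affine_independent_iff_card)
  then show ?thesis
    using V assms(2) convex_hull_image \<open>card (proj_map L ` V) = card V\<close>
    by (auto simp: simplex_def)
qed

lemma polytope_image: "polytope S \<Longrightarrow> S \<subseteq> P \<Longrightarrow> polytope (proj_map L ` S)"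
  by (metis convex_hull_image finite_imageI polytope_def)

lemma faces_image:
  "{G. G face_of proj_map L ` P \<and> aff_dim G = i}
    = image (proj_map L) ` {G. G face_of P \<and> aff_dim G = i}"
proof (intro set_eqI iffI)
  fix G assume G: "G \<in> {G. G face_of proj_map L ` P \<and> aff_dim G = i}"
  then obtain H where "H \<subseteq> P" "G = proj_map L ` H"
    by (metis (lifting) face_of_imp_subset mem_Collect_eq subset_image_iff)
  then show "G \<in> image (proj_map L) ` {G. G face_of P \<and> aff_dim G = i}"
    using G face_of_image aff_dim_image by auto
next
  fix G assume "G \<in> image (proj_map L) ` {G. G face_of P \<and> aff_dim G = i}"
  then obtain H where "H face_of P" "aff_dim H = i" "G = proj_map L ` H"
    by blast
  then show "G \<in> {G. G face_of proj_map L ` P \<and> aff_dim G = i}"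
    using face_of_image[OF face_of_imp_subset] aff_dim_image[OF face_of_imp_subset] by auto
qed

lemma card_faces_image:
  "card {G. G face_of proj_map L ` P \<and> aff_dim G = i} = card {G. G face_of P \<and> aff_dim G = i}"
  unfolding faces_image
proof (intro card_image inj_onI)
  fix G H assume "G \<in> {G. G face_of P \<and> aff_dim G = i}" "H \<in> {G. G face_of P \<and> aff_dim G = i}"
    and eq: "proj_map L ` G = proj_map L ` H"
  then have "G \<subseteq> P" "H \<subseteq> P"
    by (auto dest: face_of_imp_subset)
  then show "G = H"
    using inj_on_image_eq_iff[OF inj_on[OF order_refl]] eq by blast
qed

lemma facet_of_image:
  assumes "F facet_of P"
  shows "proj_map L ` F facet_of proj_map L ` P"
  using assms by (simp add: facet_of_def face_of_image face_of_imp_subset aff_dim_image)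

lemma simplicial_image:
  assumes "simplicial_polytope d P"
  shows "simplicial_polytope d (proj_map L ` P)"
proof -
  have P: "polytope P" "aff_dim P = int d" "\<And>F. F facet_of P \<Longrightarrow> (int d - 1) simplex F"
    using assms by (auto simp: simplicial_polytope_def)
  have "(int d - 1) simplex F" if "F facet_of proj_map L ` P" for F
  proof -
    have "F \<in> {G. G face_of proj_map L ` P \<and> aff_dim G = aff_dim P - 1}" "F \<noteq> {}"
      using that by (auto simp: facet_of_def aff_dim_image)
    then obtain H where "H facet_of P" "F = proj_map L ` H"
      unfolding faces_image by (auto simp: facet_of_def)
    then show ?thesis
      using P(3) simplex_image[OF _ facet_of_imp_subset] by simp
  qed
  with P show ?thesis
    by (auto simp: simplicial_polytope_def polytope_image aff_dim_image)
qed

end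

section \<open>Polytopes meeting in a common facet\<close>

text \<open>The faces of a simplex are the hulls of the subsets of its vertex set. A subset is
  recovered from its hull as the set of extreme points, and dimension \<open>i\<close> means
  \<open>i + 1\<close> vertices.\<close>

lemma card_faces_simplex:
  assumes "n simplex F"
  shows "card {G. G face_of F \<and> aff_dim G = int i} = nat (n + 1) choose (i + 1)"
proof -
  obtain V where V: "finite V" "\<not> affine_dependent V" "int (card V) = n + 1" "F = convex hull V"
    using assms by (auto simp: simplex)
  have sub: "\<not> affine_dependent C" "aff_dim C = int (card C) - 1" if "C \<subseteq> V" for C
    using that V affine_dependent_subset affine_independent_iff_card by blast+
  have "aff_dim (convex hull C) = int i \<longleftrightarrow> card C = i + 1" if "C \<subseteq> V" for C
    using sub(2)[OF that] by (simp add: aff_dim_convex_hull) linarith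
  then have "G face_of F \<and> aff_dim G = int i \<longleftrightarrow> (\<exists>C. C \<subseteq> V \<and> card C = i + 1 \<and> G = convex hull C)" for G
    unfolding V(4) face_of_convex_hull_affine_independent[OF V(2)]
    by metis
  then have "{G. G face_of F \<and> aff_dim G = int i} = (\<lambda>C. convex hull C) ` {C. C \<subseteq> V \<and> card C = i + 1}"
    by auto
  moreover have "inj_on (\<lambda>C. convex hull C) {C. C \<subseteq> V \<and> card C = i + 1}"
  proof (rule inj_onI)
    fix C D assume CD: "C \<in> {C. C \<subseteq> V \<and> card C = i + 1}" "D \<in> {C. C \<subseteq> V \<and> card C = i + 1}"
      "convex hull C = convex hull D"
    have ext: "x extreme_point_of (convex hull C) \<longleftrightarrow> x \<in> C" if "C \<subseteq> V" for x C
      by (rule extreme_point_of_convex_hull_affine_independent[OF sub(1)[OF that]])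
    show "C = D"
    proof (rule set_eqI)
      fix x show "x \<in> C \<longleftrightarrow> x \<in> D"
        using ext[of C x] ext[of D x] CD by simp
    qed
  qed
  ultimately have "card {G. G face_of F \<and> aff_dim G = int i} = card {C. C \<subseteq> V \<and> card C = i + 1}"
    by (simp add: card_image)
  then show ?thesis
    using V by (simp add: n_subsets flip: V(3))
qed

text \<open>The segment is connected and covered by two closed sets, each of which contains one of
  its end points.\<close>

lemma segment_meets_Int_closed:
  fixes S T :: "'a::real_normed_vector set"
  assumes "closed S" "closed T" "convex (S \<union> T)" "x \<in> S" "y \<in> T"
  obtains z where "z \<in> closed_segment x y" "z \<in> S" "z \<in> T"
proof -
  have "closed_segment x y \<subseteq> S \<union> T"
    using assms by (simp add: closed_segment_subset)
  moreover have "connected (closed_segment x y)" by simp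
  ultimately have "S \<inter> T \<inter> closed_segment x y \<noteq> {}"
    using assms unfolding connected_closed by (metis IntI UnE disjoint_iff ends_in_segment)
  then show ?thesis using that by blast
qed

lemma open_segment_refine:
  fixes a b :: "'a::real_vector"
  assumes x: "x \<in> open_segment a b" and z: "z \<in> open_segment x b"
  shows "x \<in> open_segment a z" "z \<in> open_segment a b"
proof -
  obtain s where s: "0 < s" "s < 1" "x = (1 - s) *\<^sub>R a + s *\<^sub>R b" and ab: "a \<noteq> b"
    using x by (auto simp: in_segment)
  obtain t where t: "0 < t" "t < 1" "z = (1 - t) *\<^sub>R x + t *\<^sub>R b"
    using z by (auto simp: in_segment)
  \<comment> \<open>The parameter of \<open>z\<close> on the segment from \<open>a\<close> to
    \<open>b\<close>.\<close>
  define D where "D = s + t * (1 - s)"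
  have "t * (1 - s) > 0" "(1 - t) * (1 - s) > 0"
    using s t by auto
  then have D: "s < D" "D < 1"
    by (auto simp: D_def algebra_simps)
  have z_eq: "z = (1 - D) *\<^sub>R a + D *\<^sub>R b"
    by (simp add: t(3) s(3) D_def algebra_simps)
  then show "z \<in> open_segment a b"
    using D s ab unfolding in_segment by (intro conjI exI[of _ D]) auto
  have "x = (1 - s / D) *\<^sub>R a + (s / D) *\<^sub>R z"
    using D s by (simp add: s(3) z_eq algebra_simps)
  moreover have "a \<noteq> z"
  proof
    assume az: "a = z"
    have "D *\<^sub>R (b - a) = z - a"
      by (simp add: z_eq algebra_simps)
    then have "D *\<^sub>R (b - a) = 0"
      using az by simp
    then show False using D s ab by simp
  qed
  ultimately show "x \<in> open_segment a z"
    using D s unfolding in_segment by (intro conjI exI[of _ "s / D"]) auto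
qed

section \<open>Faces of the union of two polytopes with a common facet\<close>

text \<open>The situation after the transformation has been applied to the first polytope. The
  assumption \<open>ridges\<close> prevents a face of \<open>P\<close> and a face of
  \<open>Q\<close> from merging into one face of the union across the common facet.\<close>

locale facet_union =
  fixes P Q :: "'a::euclidean_space set"
  assumes poly_P: "polytope P" and poly_Q: "polytope Q" and convex_Un: "convex (P \<union> Q)"
    and facet_P: "(P \<inter> Q) facet_of P" and facet_Q: "(P \<inter> Q) facet_of Q"
    and ridges: "\<And>G. G face_of P \<inter> Q \<Longrightarrow> G \<noteq> P \<inter> Q \<Longrightarrow> G face_of P \<union> Q"
begin

lemma commute: "facet_union Q P"
  using facet_union_axioms unfolding facet_union_def by (simp add: Int_commute Un_commute)

lemma crossing:
  assumes "x \<in> P - Q" "y \<in> Q - P"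
  obtains z where "z \<in> open_segment x y" "z \<in> P \<inter> Q"
proof -
  obtain z where "z \<in> closed_segment x y" "z \<in> P" "z \<in> Q"
    using segment_meets_Int_closed[of P Q x y] assms poly_P poly_Q convex_Un polytope_imp_closed
    by blast
  then show ?thesis
    using that[of z] assms by (auto simp: open_segment_def)
qed

lemma proper: "P - Q \<noteq> {}" "Q - P \<noteq> {}"
  using facet_P facet_Q facet_of_irrefl facet_of_imp_subset by (metis Diff_eq_empty_iff inf.absorb1 inf.absorb2)+

text \<open>A segment from \<open>P - Q\<close> to \<open>Q - P\<close> has an inner point in the
  common facet but end points outside it.\<close>

lemma Int_not_face: "\<not> (P \<inter> Q) face_of (P \<union> Q)"
proof
  assume face: "(P \<inter> Q) face_of (P \<union> Q)"
  obtain x y where "x \<in> P - Q" "y \<in> Q - P"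
    using proper by blast
  moreover from this obtain z where "z \<in> open_segment x y" "z \<in> P \<inter> Q"
    by (rule crossing)
  ultimately show False
    using face_ofD[OF face] by blast
qed

text \<open>Facets are maximal among the proper faces: a face strictly between would have a
  dimension strictly between two consecutive integers.\<close>

lemma facet_face_eq:
  assumes "G face_of P" "P \<inter> Q \<subseteq> G" "G \<noteq> P \<inter> Q"
  shows "G = P"
proof (rule ccontr)
  assume "G \<noteq> P"
  then have "aff_dim G < aff_dim P"
    using assms poly_P by (simp add: face_of_aff_dim_lt polytope_imp_convex)
  moreover have "(P \<inter> Q) face_of G"
    by (rule face_of_subset[OF facet_of_imp_face_of[OF facet_P] assms(2) face_of_imp_subset[OF assms(1)]])
  then have "aff_dim (P \<inter> Q) < aff_dim G"
    using assms by (metis face_of_aff_dim_lt face_of_imp_convex)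
  ultimately show False
    using facet_P by (simp add: facet_of_def)
qed

text \<open>A face with points on both sides contains a crossing point \<open>z\<close>. This forces
  it to contain the whole common facet, and then, by maximality of facets, both polytopes.\<close>

lemma face_of_Un_subset:
  assumes G: "G face_of P \<union> Q" and "G \<noteq> P \<union> Q"
  shows "G \<subseteq> P \<or> G \<subseteq> Q"
proof (rule ccontr)
  assume "\<not> ?thesis"
  then obtain x y where x: "x \<in> G" "x \<in> P - Q" and y: "y \<in> G" "y \<in> Q - P"
    using face_of_imp_subset[OF G] by blast
  then obtain z where z: "z \<in> open_segment x y" "z \<in> P \<inter> Q"
    using crossing by blast
  then have "z \<in> G"
    using x y face_of_imp_convex[OF G] by (meson convex_contains_open_segment subsetD)
  have PQ: "convex (P \<inter> Q)"
    using poly_P poly_Q by (simp add: convex_Int polytope_imp_convex)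
  have face: "G \<inter> (P \<inter> Q) face_of P \<inter> Q"
    using face_of_slice[OF G PQ] by (simp add: Int_absorb1 le_supI1)
  \<comment> \<open>Otherwise \<open>G\<close> cuts out a proper face of the common facet, hence by
    \<open>ridges\<close> a face of the union; it contains \<open>z\<close> and would absorb
    \<open>x\<close> and \<open>y\<close>, which lie outside the common facet.\<close>
  have "P \<inter> Q \<subseteq> G"
  proof (rule ccontr)
    assume "\<not> ?thesis"
    then have "G \<inter> (P \<inter> Q) face_of P \<union> Q"
      using ridges[OF face] by blast
    then show False
      using face_ofD[of "G \<inter> (P \<inter> Q)" _ z x y] z x y \<open>z \<in> G\<close> by blast
  qed
  have "G \<inter> P face_of P" "G \<inter> Q face_of Q"
    using face_of_slice[OF G, of P] face_of_slice[OF G, of Q] poly_P poly_Q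
    by (simp_all add: polytope_imp_convex Int_absorb1)
  then have "G \<inter> P = P" "G \<inter> Q = Q"
    using facet_face_eq[of "G \<inter> P"] facet_union.facet_face_eq[OF commute, of "G \<inter> Q"]
      \<open>P \<inter> Q \<subseteq> G\<close> x y by blast+
  then show False
    using assms face_of_imp_subset[OF G] by blast
qed

lemma face_of_Un_imp:
  assumes G: "G face_of P \<union> Q" and ne: "G \<noteq> P \<union> Q"
  shows "G \<noteq> P \<inter> Q" and "G face_of P \<and> G \<noteq> P \<or> G face_of Q \<and> G \<noteq> Q"
proof -
  show "G \<noteq> P \<inter> Q"
    using G Int_not_face by blast
  \<comment> \<open>If \<open>G\<close> were \<open>P\<close> or \<open>Q\<close>, transitivity
    would make the common facet a face of the union.\<close>
  have "P \<inter> Q face_of G" if "G = P \<or> G = Q"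
    using that facet_of_imp_face_of[OF facet_P] facet_of_imp_face_of[OF facet_Q] by auto
  then have "G \<noteq> P" "G \<noteq> Q"
    using face_of_trans[OF _ G] Int_not_face by blast+
  moreover have "G face_of P \<or> G face_of Q"
    using face_of_Un_subset[OF G ne] face_of_subset[OF G] by blast
  ultimately show "G face_of P \<and> G \<noteq> P \<or> G face_of Q \<and> G \<noteq> Q"
    by blast
qed

text \<open>The trace \<open>G \<inter> Q\<close> is a proper face of the common facet and so a face
  of the union. It settles the segments that could leave \<open>P\<close>.\<close>

lemma face_of_imp_face_of_Un:
  assumes G: "G face_of P" and "G \<noteq> P" "G \<noteq> P \<inter> Q"
  shows "G face_of P \<union> Q"
proof -
  have PQ: "convex (P \<inter> Q)"
    using poly_P poly_Q by (simp add: convex_Int polytope_imp_convex)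
  have GP: "G \<subseteq> P" using G by (rule face_of_imp_subset)
  have "G \<inter> (P \<inter> Q) face_of P \<inter> Q"
    using face_of_slice[OF G PQ] by (simp add: Int_absorb1)
  moreover have "\<not> P \<inter> Q \<subseteq> G"
    using assms facet_face_eq by blast
  ultimately have ridge: "G \<inter> Q face_of P \<union> Q"
    using ridges GP by (metis inf.absorb2 inf.orderE inf_assoc inf_le1)
  \<comment> \<open>The part of the segment from \<open>x\<close> to \<open>b\<close> crosses the
    common facet in some \<open>z\<close>. Since \<open>x\<close> lies between \<open>a\<close> and
    \<open>z\<close> in \<open>P\<close>, the face \<open>G\<close> contains \<open>z\<close>; now
    \<open>z\<close> lies in the trace, which absorbs \<open>a\<close> and \<open>b\<close>.\<close>
  have step: "a \<in> G \<and> b \<in> G"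
    if ab: "a \<in> P - Q" "b \<in> Q - P" and x: "x \<in> G" "x \<notin> Q" "x \<in> open_segment a b" for a b x
  proof -
    have "x \<in> P - Q" using x GP by blast
    then obtain z where z: "z \<in> open_segment x b" "z \<in> P \<inter> Q"
      using crossing ab by blast
    have "x \<in> open_segment a z" and zab: "z \<in> open_segment a b"
      using open_segment_refine[OF x(3) z(1)] by auto
    then have "z \<in> G"
      using face_ofD[OF G, of x a z] ab z x(1) by blast
    then show ?thesis
      using face_ofD[OF ridge zab] z ab by blast
  qed
  show ?thesis
    unfolding face_of_def
  proof (intro conjI ballI impI)
    show "G \<subseteq> P \<union> Q" using GP by blast
    show "convex G" using G by (rule face_of_imp_convex)
    fix a b x assume ab: "a \<in> P \<union> Q" "b \<in> P \<union> Q" and x: "x \<in> G" "x \<in> open_segment a b"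
    have "a \<in> G \<and> b \<in> G"
    proof (cases "x \<in> Q")
      case True
      then show ?thesis using face_ofD[OF ridge x(2) ab] x by blast
    next
      case False
      then have "\<not> (a \<in> Q \<and> b \<in> Q)"
        using x poly_Q by (meson convex_contains_open_segment polytope_imp_convex subsetD)
      then consider "a \<in> P" "b \<in> P" | "a \<in> P - Q" "b \<in> Q - P" | "b \<in> P - Q" "a \<in> Q - P"
        using ab by blast
      then show ?thesis
        using face_ofD[OF G x(2) _ _ x(1)] step[OF _ _ x(1) False] x(2) open_segment_commute
        by cases blast+
    qed
    then show "a \<in> G" "b \<in> G" by auto
  qed
qed

lemma proper_faces_Un:
  "{G. G face_of P \<union> Q \<and> G \<noteq> P \<union> Q} =
    {G. G face_of P \<and> G \<noteq> P \<and> G \<noteq> P \<inter> Q} \<union> {G. G face_of Q \<and> G \<noteq> Q \<and> G \<noteq> P \<inter> Q}"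
proof -
  have "G face_of P \<union> Q \<and> G \<noteq> P \<union> Q" if "G face_of P" "G \<noteq> P" "G \<noteq> P \<inter> Q" for G
    using that face_of_imp_face_of_Un face_of_imp_subset proper by fastforce
  moreover have "G face_of P \<union> Q \<and> G \<noteq> P \<union> Q" if "G face_of Q" "G \<noteq> Q" "G \<noteq> P \<inter> Q" for G
    using that facet_union.face_of_imp_face_of_Un[OF commute, of G] face_of_imp_subset proper
    by (fastforce simp: Int_commute Un_commute)
  ultimately show ?thesis
    using face_of_Un_imp by blast
qed

lemma proper_faces_Int:
  "{G. G face_of P \<and> G \<noteq> P \<and> G \<noteq> P \<inter> Q} \<inter> {G. G face_of Q \<and> G \<noteq> Q \<and> G \<noteq> P \<inter> Q} =
    {G. G face_of P \<inter> Q \<and> G \<noteq> P \<inter> Q}"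
proof -
  have "P \<inter> Q face_of P" "P \<inter> Q face_of Q"
    using facet_P facet_Q by (simp_all add: facet_of_imp_face_of)
  moreover have "\<not> P \<subseteq> Q" "\<not> Q \<subseteq> P" using proper by auto
  ultimately have "G face_of P \<and> G \<noteq> P \<and> G face_of Q \<and> G \<noteq> Q \<longleftrightarrow> G face_of P \<inter> Q" for G
    using face_of_face[of "P \<inter> Q" P G] face_of_face[of "P \<inter> Q" Q G]
      face_of_imp_subset[of G P] face_of_imp_subset[of G Q] by auto
  then show ?thesis by blast
qed

lemma aff_dim_eq: "aff_dim P = aff_dim Q"
  using facet_P facet_Q by (simp add: facet_of_def)

section \<open>Dimension and face numbers of the union\<close>

lemma polytope_Un: "polytope (P \<union> Q)"
proof -
  obtain V W where V: "finite V" "P = convex hull V" and W: "finite W" "Q = convex hull W"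
    using poly_P poly_Q by (auto simp: polytope_def)
  have "convex hull (V \<union> W) = P \<union> Q"
  proof (rule subset_antisym)
    show "convex hull (V \<union> W) \<subseteq> P \<union> Q"
      using convex_Un by (intro hull_minimal) (auto simp: V W hull_inc)
    show "P \<union> Q \<subseteq> convex hull (V \<union> W)"
      by (simp add: V W hull_mono)
  qed
  then show ?thesis
    using V W by (metis finite_UnI polytope_convex_hull)
qed

text \<open>Every facet of the union is a proper face of \<open>P\<close> or of \<open>Q\<close> and
  thus has smaller dimension than \<open>P\<close>. Positive dimension ensures that the union has a
  facet.\<close>

lemma aff_dim_Un:
  assumes "aff_dim P > 0"
  shows "aff_dim (P \<union> Q) = aff_dim P"
proof -
  have le: "aff_dim P \<le> aff_dim (P \<union> Q)"
    by (simp add: aff_dim_subset)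
  then obtain G where G: "G facet_of P \<union> Q"
    using polytope_facet_exists[OF polytope_Un] assms by auto
  then have "G \<in> {G. G face_of P \<union> Q \<and> G \<noteq> P \<union> Q}"
    by (auto simp: facet_of_def)
  then have "aff_dim G < aff_dim P"
    unfolding proper_faces_Un
    using face_of_aff_dim_lt[of P G] face_of_aff_dim_lt[of Q G] poly_P poly_Q aff_dim_eq
    by (auto simp: polytope_imp_convex)
  then show ?thesis
    using G le by (simp add: facet_of_def)
qed

lemma faces_Un:
  assumes "aff_dim P > 0" "i < aff_dim P"
  shows "{G. G face_of P \<union> Q \<and> aff_dim G = i} =
    ({G. G face_of P \<and> aff_dim G = i} - {P \<inter> Q}) \<union> ({G. G face_of Q \<and> aff_dim G = i} - {P \<inter> Q})"
proof -
  have "{G. G face_of P \<union> Q \<and> aff_dim G = i} = {G. G face_of P \<union> Q \<and> G \<noteq> P \<union> Q} \<inter> {G. aff_dim G = i}"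
    using assms aff_dim_Un by auto
  also have "\<dots> = ({G. G face_of P \<and> aff_dim G = i} - {P \<inter> Q}) \<union> ({G. G face_of Q \<and> aff_dim G = i} - {P \<inter> Q})"
    unfolding proper_faces_Un using assms(2) aff_dim_eq by auto
  finally show ?thesis .
qed

lemma faces_Int:
  assumes "i < aff_dim P"
  shows "({G. G face_of P \<and> aff_dim G = i} - {P \<inter> Q}) \<inter> ({G. G face_of Q \<and> aff_dim G = i} - {P \<inter> Q})
    = {G. G face_of P \<inter> Q \<and> aff_dim G = i} - {P \<inter> Q}"
proof -
  have "({G. G face_of P \<and> aff_dim G = i} - {P \<inter> Q}) \<inter> ({G. G face_of Q \<and> aff_dim G = i} - {P \<inter> Q})
    = ({G. G face_of P \<and> G \<noteq> P \<and> G \<noteq> P \<inter> Q} \<inter> {G. G face_of Q \<and> G \<noteq> Q \<and> G \<noteq> P \<inter> Q}) \<inter> {G. aff_dim G = i}"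
    using assms aff_dim_eq by auto
  also have "\<dots> = {G. G face_of P \<inter> Q \<and> aff_dim G = i} - {P \<inter> Q}"
    unfolding proper_faces_Int by auto
  finally show ?thesis .
qed

text \<open>Inclusion-exclusion for the two families of proper faces without the common facet; what
  they share are the proper faces of that facet.\<close>

lemma f_vector_Un:
  assumes d: "d \<ge> 1" "aff_dim P = int d" and simplex: "(int d - 1) simplex (P \<inter> Q)"
  shows "f_vector d (P \<union> Q) = modified_plus d (f_vector d P) (f_vector d Q)"
proof
  fix i
  show "f_vector d (P \<union> Q) i = modified_plus d (f_vector d P) (f_vector d Q) i"
  proof (cases "i < d")
    case True
    let ?A = "\<lambda>S. {G. G face_of S \<and> aff_dim G = int i}"
    have fin: "finite (?A P)" "finite (?A Q)" "finite (?A (P \<inter> Q))"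
      using finite_polytope_faces[OF poly_P] finite_polytope_faces[OF poly_Q]
        finite_polytope_faces[OF polytope_Int[OF poly_P poly_Q]]
      by (auto intro: rev_finite_subset)
    have "aff_dim P > 0" "int i < aff_dim P"
      using d True by auto
    then have "?A (P \<union> Q) = (?A P - {P \<inter> Q}) \<union> (?A Q - {P \<inter> Q})"
      and Int: "(?A P - {P \<inter> Q}) \<inter> (?A Q - {P \<inter> Q}) = ?A (P \<inter> Q) - {P \<inter> Q}"
      using faces_Un faces_Int by auto
    then have sum: "card (?A (P \<union> Q)) + card (?A (P \<inter> Q) - {P \<inter> Q})
        = card (?A P - {P \<inter> Q}) + card (?A Q - {P \<inter> Q})"
      using fin by (metis (no_types, lifting) card_Un_Int finite_Diff)
    have facets: "P \<inter> Q face_of P" "P \<inter> Q face_of Q" "P \<inter> Q face_of P \<inter> Q"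
      using facet_P facet_Q simplex
      by (auto simp: facet_of_imp_face_of convex_simplex face_of_refl)
    have dim: "aff_dim (P \<inter> Q) = int d - 1"
      using simplex by (rule aff_dim_simplex)
    have binom: "card (?A (P \<inter> Q)) = d choose (i + 1)"
      using card_faces_simplex[OF simplex] by simp
    show ?thesis
    proof (cases "i = d - 1")
      case last: True
      \<comment> \<open>In dimension \<open>d - 1\<close> the common facet is removed from both
        families, and it is its own only face of this dimension: this is the entry 2 of the
        correction vector.\<close>
      then have "P \<inter> Q \<in> ?A P" "P \<inter> Q \<in> ?A Q" "P \<inter> Q \<in> ?A (P \<inter> Q)"
        using facets dim d by auto
      then have "int (card (?A (P \<union> Q))) + (int (card (?A (P \<inter> Q))) - 1)
          = (int (card (?A P)) - 1) + (int (card (?A Q)) - 1)"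
        using sum fin by (smt (verit) card_Suc_Diff1 of_nat_Suc of_nat_add)
      then show ?thesis
        using last d binom by (simp add: f_vector_def modified_plus_def simplex_f_vector_2_def)
    next
      case False
      \<comment> \<open>In lower dimensions nothing is removed, and the shared faces are those
        counted by the binomial coefficient.\<close>
      then have "int i \<noteq> aff_dim (P \<inter> Q)"
        using dim True by auto
      then have "?A P - {P \<inter> Q} = ?A P" "?A Q - {P \<inter> Q} = ?A Q" "?A (P \<inter> Q) - {P \<inter> Q} = ?A (P \<inter> Q)"
        by auto
      with sum have "int (card (?A (P \<union> Q))) + int (card (?A (P \<inter> Q)))
          = int (card (?A P)) + int (card (?A Q))"
        by (simp flip: of_nat_add)
      then show ?thesis
        using False True binom by (simp add: f_vector_def modified_plus_def simplex_f_vector_2_def)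
    qed
  qed (use d in \<open>auto simp: f_vector_def modified_plus_def simplex_f_vector_2_def\<close>)
qed

lemma simplicial_Un:
  assumes d: "d \<ge> 1" and P: "simplicial_polytope d P" and Q: "simplicial_polytope d Q"
  shows "simplicial_polytope d (P \<union> Q)"
  unfolding simplicial_polytope_def
proof (intro conjI allI impI)
  have dP: "aff_dim P = int d" "aff_dim Q = int d"
    using P Q by (auto simp: simplicial_polytope_def)
  then show dU: "aff_dim (P \<union> Q) = int d"
    using aff_dim_Un d by simp
  fix G assume "G facet_of P \<union> Q"
  then have "G \<in> {G. G face_of P \<union> Q \<and> aff_dim G = int d - 1}" "G \<noteq> {}"
    by (auto simp: facet_of_def dU)
  then have "G facet_of P \<or> G facet_of Q"
    using faces_Un[of "int d - 1"] d dP by (auto simp: facet_of_def)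
  then show "(int d - 1) simplex G"
    using P Q by (auto simp: simplicial_polytope_def)
qed (rule polytope_Un)

end

section \<open>Existence of a glueing\<close>

lemma strict_halfspaces_perturb:
  fixes x :: "'a::real_inner"
  assumes "finite K" "\<And>h. h \<in> K \<Longrightarrow> \<alpha> h \<bullet> x < \<beta> h"
  shows "\<exists>e>0. \<forall>h\<in>K. \<alpha> h \<bullet> (x + e *\<^sub>R v) < \<beta> h"
proof -
  have "\<forall>\<^sub>F e in at_right 0. \<alpha> h \<bullet> (x + e *\<^sub>R v) < \<beta> h" if "h \<in> K" for h
  proof -
    have "((\<lambda>e. \<alpha> h \<bullet> (x + e *\<^sub>R v)) \<longlongrightarrow> \<alpha> h \<bullet> (x + 0 *\<^sub>R v)) (at_right 0)"
      by (intro tendsto_intros)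
    then show ?thesis
      using assms(2)[OF that] by (auto intro: order_tendstoD)
  qed
  then have "\<forall>\<^sub>F e in at_right (0::real). e > 0 \<and> (\<forall>h\<in>K. \<alpha> h \<bullet> (x + e *\<^sub>R v) < \<beta> h)"
    using assms(1) by (simp add: eventually_conj eventually_ball_finite eventually_at_right_less)
  then show ?thesis
    using eventually_happens'[OF trivial_limit_at_right_real] by blast
qed

lemma affine_hull_eq_aff_dim:
  fixes S T :: "'a::euclidean_space set"
  assumes "S \<subseteq> affine hull T" "aff_dim S = aff_dim T"
  shows "affine hull S = affine hull T"
  using assms aff_dim_eq_full_gen[of S "affine hull T"] by simp

text \<open>Otherwise \<open>z\<close> and \<open>F\<close> would affinely span the hull of
  \<open>Q\<close>, so \<open>Q\<close> would lie in the hyperplane and coincide with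
  \<open>F\<close>.\<close>

lemma facet_hyperplane_affine_hull:
  assumes F: "F facet_of Q" and n: "F = Q \<inter> {x. n \<bullet> x = b}"
    and z: "z \<in> affine hull Q" "n \<bullet> z = b"
  shows "z \<in> affine hull F"
proof (rule ccontr)
  assume "z \<notin> affine hull F"
  then have "aff_dim (insert z F) = aff_dim Q"
    using F by (simp add: aff_dim_insert facet_of_def)
  moreover have "insert z F \<subseteq> affine hull Q"
    using z n hull_subset[of Q affine] by auto
  ultimately have "affine hull (insert z F) = affine hull Q"
    by (intro affine_hull_eq_aff_dim)
  then have "Q \<subseteq> affine hull (insert z F)"
    using hull_subset[of Q affine] by simp
  also have "\<dots> \<subseteq> {x. n \<bullet> x = b}"
    using n z by (intro hull_minimal affine_hyperplane) auto
  finally have "F = Q" using n by blast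
  then show False using F by simp
qed

lemma facet_exposed:
  assumes "polytope Q" "F facet_of Q"
  obtains n b where "Q \<subseteq> {x. n \<bullet> x \<le> b}" "F = Q \<inter> {x. n \<bullet> x = b}"
proof -
  have "F exposed_face_of Q"
    using assms by (simp add: exposed_face_of_polyhedron polytope_imp_polyhedron facet_of_imp_face_of)
  then show ?thesis
    using that by (auto simp: exposed_face_of_def)
qed

text \<open>Leaving \<open>Q\<close> through a relative interior point \<open>w\<close> of
  \<open>F\<close>, a short step away from a point \<open>q\<close> of \<open>Q\<close> off
  \<open>F\<close> violates only the inequalities that are tight on all of \<open>F\<close>.\<close>

lemma point_beyond_facet:
  fixes Q :: "'a::euclidean_space set"
  assumes Q: "polytope Q" and F: "F facet_of Q"
  obtains a where "a \<notin> affine hull F" "convex (Q \<union> convex hull (insert a F))"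
    "Q \<inter> convex hull (insert a F) = F"
    "\<And>G. G face_of F \<Longrightarrow> G \<noteq> F \<Longrightarrow> G face_of Q \<union> convex hull (insert a F)"
proof -
  have cQ: "convex Q" and FQ: "F face_of Q" and F_sub: "F \<subseteq> Q" and F_ne: "F \<noteq> {}"
    using Q F by (auto simp: polytope_imp_convex facet_of_def face_of_imp_subset)
  have cF: "convex F"
    using FQ by (rule face_of_imp_convex)
  obtain H where H: "finite H" "Q = affine hull Q \<inter> \<Inter>H"
      "\<forall>h\<in>H. \<exists>a b. a \<noteq> 0 \<and> h = {x. a \<bullet> x \<le> b}"
    using polytope_imp_polyhedron[OF Q] unfolding polyhedron_Int_affine by blast
  from H(3) obtain \<alpha> \<beta> where \<alpha>\<beta>: "\<And>h. h \<in> H \<Longrightarrow> h = {x. \<alpha> h \<bullet> x \<le> \<beta> h}"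
    by metis
  then have in_Q: "x \<in> Q \<longleftrightarrow> x \<in> affine hull Q \<and> (\<forall>h\<in>H. \<alpha> h \<bullet> x \<le> \<beta> h)" for x
    using H(2) by blast
  obtain n b where n: "Q \<subseteq> {x. n \<bullet> x \<le> b}" "F = Q \<inter> {x. n \<bullet> x = b}"
    by (rule facet_exposed[OF Q F])
  \<comment> \<open>No minimality of \<open>H\<close> is assumed, so several half-spaces may cut out the facet \<open>F\<close>; \<open>K\<close> collects
    the others.\<close>
  define K where "K = {h \<in> H. \<not> F \<subseteq> {x. \<alpha> h \<bullet> x = \<beta> h}}"
  have K: "finite K" "K \<subseteq> H"
    using H(1) by (auto simp: K_def)
  \<comment> \<open>On the supporting hyperplane of \<open>F\<close> only the half-spaces in
    \<open>K\<close> have to be checked: the others are tight on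
    \<open>affine hull F\<close>.\<close>
  have in_QK: "z \<in> F"
    if z: "z \<in> affine hull Q" "n \<bullet> z = b" "\<And>h. h \<in> K \<Longrightarrow> \<alpha> h \<bullet> z \<le> \<beta> h" for z
  proof -
    have "z \<in> affine hull F"
      using facet_hyperplane_affine_hull[OF F n(2) z(1,2)] .
    moreover have "affine hull F \<subseteq> {x. \<alpha> h \<bullet> x = \<beta> h}" if "h \<in> H - K" for h
      using that by (intro hull_minimal affine_hyperplane) (auto simp: K_def)
    ultimately have "\<forall>h\<in>H. \<alpha> h \<bullet> z \<le> \<beta> h"
      using z(3) by fastforce
    with z in_Q n(2) show ?thesis by blast
  qed
  obtain w where w: "w \<in> rel_interior F"
    using rel_interior_eq_empty[OF cF] F_ne by blast
  then have wF: "w \<in> F"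
    using rel_interior_subset[of F] by blast
  have w_strict: "\<alpha> h \<bullet> w < \<beta> h" if h: "h \<in> K" for h
  proof -
    have le: "F \<subseteq> {x. \<alpha> h \<bullet> x \<le> \<beta> h}"
      using h K in_Q F_sub by blast
    then have "F \<inter> {x. \<alpha> h \<bullet> x = \<beta> h} face_of F"
      by (intro face_of_Int_supporting_hyperplane_le[OF cF]) blast
    moreover have "F \<inter> {x. \<alpha> h \<bullet> x = \<beta> h} \<noteq> F"
      using h by (auto simp: K_def)
    ultimately have "\<alpha> h \<bullet> w \<noteq> \<beta> h"
      using face_of_disjoint_rel_interior[of "F \<inter> {x. \<alpha> h \<bullet> x = \<beta> h}" F] w wF by blast
    then show ?thesis
      using le wF by (auto simp: order_less_le)
  qed
  obtain q where q: "q \<in> Q" "q \<notin> F"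
    using F F_sub facet_of_irrefl[of Q] by (metis subset_antisym subsetI)
  obtain e where e: "e > 0" "\<And>h. h \<in> K \<Longrightarrow> \<alpha> h \<bullet> (w + e *\<^sub>R (w - q)) < \<beta> h"
    using strict_halfspaces_perturb[OF K(1), of \<alpha> w \<beta> "w - q"] w_strict by blast
  define a where "a = w + e *\<^sub>R (w - q)"
  have aK: "\<alpha> h \<bullet> a < \<beta> h" if "h \<in> K" for h
    using e that by (simp add: a_def)
  have "n \<bullet> w = b" "n \<bullet> q < b"
    using wF q n by force+
  then have na: "n \<bullet> a > b"
    using e(1) by (simp add: a_def inner_simps)
  have aQ: "a \<in> affine hull Q"
    unfolding a_def using q F_sub wF
    by (intro mem_affine_3_minus affine_affine_hull) (auto simp: hull_inc)
  let ?T = "convex hull (insert a F)"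
  have T: "x \<in> ?T \<longleftrightarrow> (\<exists>f\<in>F. x \<in> closed_segment f a)" for x
    using cF F_ne by (auto simp: convex_hull_insert_segments hull_same closed_segment_commute)
  \<comment> \<open>Since \<open>a\<close> is strictly inside every half-space of \<open>K\<close>,
    a point of the pyramid can reach its boundary only in the base \<open>F\<close>.\<close>
  have T_K: "x \<in> Q"
    if "x \<in> ?T" "h \<in> K" "\<alpha> h \<bullet> x \<ge> \<beta> h" for x h
  proof -
    from that obtain f t where f: "f \<in> F" "0 \<le> t" "t \<le> 1" "x = (1 - t) *\<^sub>R f + t *\<^sub>R a"
      by (auto simp: T in_segment)
    then have "\<alpha> h \<bullet> f \<le> \<beta> h"
      using that K F_sub in_Q by blast
    then have "(1 - t) * (\<alpha> h \<bullet> f) \<le> (1 - t) * \<beta> h"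
      using f by (simp add: mult_left_mono)
    moreover have "t * (\<alpha> h \<bullet> a) < t * \<beta> h" if "t \<noteq> 0"
      using that f aK \<open>h \<in> K\<close> by simp
    ultimately have "t = 0"
      using that(3) f(4) by (auto simp: inner_simps algebra_simps)
    then show ?thesis using f F_sub by auto
  qed
  have QT_K: "\<alpha> h \<bullet> x \<le> \<beta> h" if "x \<in> Q \<union> ?T" "h \<in> K" for x h
    using that T_K[of x h] in_Q[of x] K(2) linear[of "\<beta> h" "\<alpha> h \<bullet> x"] by blast
  have hull: "convex hull (insert a Q) = Q \<union> ?T"
  proof
    show "Q \<union> ?T \<subseteq> convex hull (insert a Q)"
      using hull_mono[OF insert_mono[OF F_sub], of convex a] hull_mono[OF subset_insertI, of convex Q a] hull_same[of convex Q] cQ by simp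
    show "convex hull (insert a Q) \<subseteq> Q \<union> ?T"
    proof
      fix x assume "x \<in> convex hull (insert a Q)"
      then obtain y where y: "y \<in> Q" "x \<in> closed_segment y a"
        using q cQ by (auto simp: convex_hull_insert_segments hull_same closed_segment_commute split: if_splits)
      \<comment> \<open>The parameter at which the segment from \<open>y\<close> to \<open>a\<close>
        meets the hyperplane of \<open>F\<close>. The meeting point lies in \<open>F\<close> and
        splits the segment into a part in \<open>Q\<close> and a part in the pyramid.\<close>
      define s where "s = (b - n \<bullet> y) / (n \<bullet> a - n \<bullet> y)"
      define z where "z = (1 - s) *\<^sub>R y + s *\<^sub>R a"
      have ny: "n \<bullet> y \<le> b"
        using y n by blast
      then have s: "0 \<le> s" "s \<le> 1"
        using na by (auto simp: s_def divide_simps)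
      have z_seg: "z \<in> closed_segment y a"
        using s by (auto simp: z_def in_segment)
      have "n \<bullet> z = n \<bullet> y + s * (n \<bullet> a - n \<bullet> y)"
        by (simp add: z_def inner_simps algebra_simps)
      then have "n \<bullet> z = b"
        using na ny by (simp add: s_def)
      moreover have "z \<in> affine hull Q"
        unfolding z_def using y aQ by (intro mem_affine) (auto simp: hull_inc)
      moreover have "\<alpha> h \<bullet> z \<le> \<beta> h" if "h \<in> K" for h
      proof -
        have "closed_segment y a \<subseteq> {x. \<alpha> h \<bullet> x \<le> \<beta> h}"
          using that y K in_Q aK by (intro closed_segment_subset convex_halfspace_le) force+
        then show ?thesis using z_seg by blast
      qed
      ultimately have zF: "z \<in> F"
        using in_QK by blast
      have "x \<in> closed_segment y z \<or> x \<in> closed_segment z a"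
        using Un_closed_segment[OF z_seg] y by blast
      moreover have "closed_segment y z \<subseteq> Q"
        using y zF F_sub cQ by (intro closed_segment_subset) auto
      ultimately show "x \<in> Q \<union> ?T"
        using T zF by blast
    qed
  qed
  show ?thesis
  proof (rule that)
    have "affine hull F \<subseteq> {x. n \<bullet> x = b}"
      using n by (intro hull_minimal affine_hyperplane) auto
    then show "a \<notin> affine hull F" using na by auto
    show "convex (Q \<union> ?T)"
      using convex_convex_hull[of "insert a Q"] by (simp add: hull)
    show "Q \<inter> ?T = F"
    proof
      show "F \<subseteq> Q \<inter> ?T"
        using F_sub by (auto intro: hull_inc)
      show "Q \<inter> ?T \<subseteq> F"
      proof
        fix x assume x: "x \<in> Q \<inter> ?T"
        then obtain f t where f: "f \<in> F" "0 \<le> t" "t \<le> 1" "x = (1 - t) *\<^sub>R f + t *\<^sub>R a"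
          by (auto simp: T in_segment)
        then have "n \<bullet> f = b" using n by blast
        then have "n \<bullet> x = b + t * (n \<bullet> a - b)"
          by (simp add: f(4) inner_add_right algebra_simps)
        moreover have "n \<bullet> x \<le> b" using x n by blast
        moreover have "t * (n \<bullet> a - b) \<ge> 0" using f na by simp
        ultimately show "x \<in> F"
          using x n by auto
      qed
    qed
  next
    fix G assume G: "G face_of F" "G \<noteq> F"
    have GQ: "G face_of Q"
      using face_of_trans[OF G(1) FQ] .
    \<comment> \<open>If all inequalities of \<open>K\<close> were strict at \<open>x\<close>, each
      segment in \<open>F\<close> from a point \<open>y\<close> to \<open>x\<close> could be
      prolonged beyond \<open>x\<close> within \<open>F\<close>. Then \<open>G\<close> would absorb
      every \<open>y\<close> and equal \<open>F\<close>.\<close>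
    have tight: "\<exists>h\<in>K. \<alpha> h \<bullet> x = \<beta> h" if x: "x \<in> G" for x
    proof (rule ccontr)
      assume "\<not> ?thesis"
      moreover have "x \<in> F" using x face_of_imp_subset[OF G(1)] by blast
      ultimately have strict: "\<alpha> h \<bullet> x < \<beta> h" if "h \<in> K" for h
        using that K F_sub in_Q by (metis order_less_le subsetD)
      have "y \<in> G" if y: "y \<in> F" for y
      proof (cases "y = x")
        case False
        obtain e where e: "e > 0" "\<And>h. h \<in> K \<Longrightarrow> \<alpha> h \<bullet> (x + e *\<^sub>R (x - y)) < \<beta> h"
          using strict_halfspaces_perturb[OF K(1), of \<alpha> x \<beta> "x - y"] strict by blast
        let ?z = "x + e *\<^sub>R (x - y)"
        have "?z \<in> affine hull Q"
          using \<open>x \<in> F\<close> y F_sub by (intro mem_affine_3_minus affine_affine_hull) (auto simp: hull_inc)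
        moreover have "n \<bullet> x = b" "n \<bullet> y = b"
          using \<open>x \<in> F\<close> y n by auto
        then have "n \<bullet> ?z = b"
          by (simp add: inner_simps)
        ultimately have zF: "?z \<in> F"
          using e by (intro in_QK) (auto simp: less_imp_le)
        define r where "r = 1 / (1 + e)"
        have r: "0 < r" "r < 1" "r * e = 1 - r"
          using e(1) by (auto simp: r_def field_simps)
        have "x = (1 - r) *\<^sub>R y + r *\<^sub>R ?z"
          by (simp only: scaleR_add_right scaleR_scaleR r(3)) (simp add: algebra_simps)
        moreover have "y \<noteq> ?z"
        proof
          assume yz: "y = ?z"
          have "(1 + e) *\<^sub>R (x - y) = ?z - y" by (simp add: algebra_simps)
          also have "\<dots> = 0" using yz by simp
          finally have "(1 + e) *\<^sub>R (x - y) = 0" .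
          then show False using e False by simp
        qed
        ultimately have "x \<in> open_segment y ?z"
          using r unfolding in_segment by blast
        then show ?thesis
          using face_ofD[OF G(1) _ y zF x] by blast
      qed (use x in simp)
      then show False
        using G(2) face_of_imp_subset[OF G(1)] by blast
    qed
    show "G face_of Q \<union> ?T"
      unfolding face_of_def
    proof (intro conjI ballI impI)
      show "G \<subseteq> Q \<union> ?T" "convex G"
        using GQ by (auto dest: face_of_imp_subset face_of_imp_convex)
      fix u v x assume uv: "u \<in> Q \<union> ?T" "v \<in> Q \<union> ?T" and x: "x \<in> G" "x \<in> open_segment u v"
      obtain h where h: "h \<in> K" "\<alpha> h \<bullet> x = \<beta> h"
        using tight[OF x(1)] by blast
      obtain t where t: "0 < t" "t < 1" "x = (1 - t) *\<^sub>R u + t *\<^sub>R v"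
        using x(2) by (auto simp: in_segment)
      have le: "\<alpha> h \<bullet> u \<le> \<beta> h" "\<alpha> h \<bullet> v \<le> \<beta> h"
        using QT_K uv h by auto
      \<comment> \<open>The slacks at \<open>u\<close> and \<open>v\<close> are nonnegative and
        their weighted mean is the slack at \<open>x\<close>, which is 0. Both end points are
        therefore tight and lie in \<open>Q\<close>, where \<open>G\<close> is known to be a
        face.\<close>
      have sum: "(1 - t) * (\<beta> h - \<alpha> h \<bullet> u) + t * (\<beta> h - \<alpha> h \<bullet> v) = 0"
        using h(2) unfolding t(3) by (simp add: inner_add_right algebra_simps)
      have "(1 - t) * (\<beta> h - \<alpha> h \<bullet> u) \<ge> 0" "t * (\<beta> h - \<alpha> h \<bullet> v) \<ge> 0"
        using t le by auto
      then have "(1 - t) * (\<beta> h - \<alpha> h \<bullet> u) = 0" "t * (\<beta> h - \<alpha> h \<bullet> v) = 0"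
        using sum by linarith+
      then have "\<alpha> h \<bullet> u = \<beta> h" "\<alpha> h \<bullet> v = \<beta> h"
        using t by auto
      then have "u \<in> Q" "v \<in> Q"
        using uv T_K h(1) by auto
      then show "u \<in> G" "v \<in> G"
        using face_ofD[OF GQ x(2) _ _ x(1)] by auto
    qed
  qed
qed

section \<open>Moving a polytope into a pyramid over a simplex\<close>

text \<open>Both sets are completed to bases; the added vectors are equal in number and can be
  matched arbitrarily.\<close>

lemma linear_bij_extend:
  fixes B C :: "'b::euclidean_space set"
  assumes B: "independent B" and C: "independent C" and g: "bij_betw g B C"
  obtains f where "linear f" "bij f" "\<And>x. x \<in> B \<Longrightarrow> f x = g x"
proof -
  obtain B' where B': "B \<subseteq> B'" "independent B'" "UNIV \<subseteq> span B'"
    by (rule maximal_independent_subset_extend[OF subset_UNIV B]) auto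
  obtain C' where C': "C \<subseteq> C'" "independent C'" "UNIV \<subseteq> span C'"
    by (rule maximal_independent_subset_extend[OF subset_UNIV C]) auto
  have fin: "finite B'" "finite C'"
    using B' C' by (auto simp: independent_imp_finite)
  have "card B' = dim (UNIV :: 'b set)" "card C' = dim (UNIV :: 'b set)"
    using basis_card_eq_dim[OF subset_UNIV B'(3,2)] basis_card_eq_dim[OF subset_UNIV C'(3,2)] by auto
  moreover have "card B = card C"
    using g by (rule bij_betw_same_card)
  ultimately have "card (B' - B) = card (C' - C)"
    using B' C' fin by (simp add: card_Diff_subset finite_subset)
  then obtain k where k: "bij_betw k (B' - B) (C' - C)"
    using fin by (metis finite_Diff finite_same_card_bij)
  define m where "m x = (if x \<in> B then g x else k x)" for x
  have "m ` B = C" "m ` (B' - B) = C' - C"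
    using g k by (auto simp: m_def bij_betw_def)
  then have m: "m ` B' = C'"
    using B'(1) C'(1) by (metis Un_Diff_cancel image_Un sup.absorb2)
  obtain f where f: "linear f" "\<And>x. x \<in> B' \<Longrightarrow> f x = m x"
    using linear_independent_extend[OF B'(2), of m] by blast
  have "range f = span (f ` B')"
    using B'(3) linear_span_image[OF f(1), of B'] by auto
  also have "f ` B' = C'"
    using f(2) m by (simp cong: image_cong)
  finally have "surj f"
    using C'(3) by auto
  then have "bij f"
    using f(1) by (simp add: bij_def linear_surjective_imp_injective)
  moreover have "f x = g x" if "x \<in> B" for x
    using f(2)[of x] B' that by (auto simp: m_def)
  ultimately show ?thesis
    using that f(1) by blast
qed

lemma independent_homogenize:
  fixes U :: "'a::euclidean_space set"
  assumes "\<not> affine_dependent U"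
  shows "independent ((\<lambda>x. (x, 1::real)) ` U)"
proof (rule card_le_dim_spanning[OF order_refl span_superset])
  have U: "finite U" "aff_dim U = int (card U) - 1"
    using assms by (auto simp: affine_independent_iff_card)
  then show "finite ((\<lambda>x. (x, 1::real)) ` U)" by simp
  show "card ((\<lambda>x. (x, 1::real)) ` U) \<le> dim ((\<lambda>x. (x, 1::real)) ` U)"
    using aff_dim_homogenize[of U] U by (simp add: card_image inj_on_def)
qed

text \<open>\<open>L\<close> is a shear \<open>L2\<close> followed by a change of basis
  \<open>L1\<close>. The shear brings the lifted points of \<open>P\<close> into the cone over
  \<open>V\<close> and an extra point \<open>p\<close>, and \<open>L1\<close> takes this cone to the
  one over \<open>W\<close> and \<open>a\<close>.\<close>

lemma proj_map_onto_simplex: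
  fixes P :: "'a::euclidean_space set"
  assumes P: "polytope P" and F: "convex hull V facet_of P" and V: "\<not> affine_dependent V"
    and W: "\<not> affine_dependent W" and card: "card V = card W" and a: "a \<notin> affine hull W"
  obtains L where "projective_transformation L" "\<And>x. x \<in> P \<Longrightarrow> snd (L (x, 1)) > 0"
    "proj_map L ` (convex hull V) = convex hull W" "proj_map L ` P \<subseteq> convex hull (insert a W)"
proof -
  have fin: "finite V" "finite W"
    using V W aff_independent_finite by auto
  obtain n b where n: "P \<subseteq> {x. n \<bullet> x \<le> b}" "convex hull V = P \<inter> {x. n \<bullet> x = b}"
    by (rule facet_exposed[OF P F])
  have FP: "convex hull V \<subseteq> P"
    using F by (rule facet_of_imp_subset)
  then obtain p where p: "p \<in> P" "p \<notin> convex hull V"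
    using F facet_of_irrefl[of P] by (metis subset_antisym subsetI)
  then have np: "n \<bullet> p < b"
    using n by force
  have nV: "n \<bullet> v = b" if "v \<in> V" for v
    using hull_inc[OF that, of convex] n(2) by auto
  then have "affine hull V \<subseteq> {x. n \<bullet> x = b}"
    by (intro hull_minimal affine_hyperplane) auto
  then have pV: "p \<notin> affine hull V"
    using np by auto
  then have "p \<notin> V"
    using hull_inc[of p V affine] by blast
  define U where "U = insert p V"
  have U: "finite U" "\<not> affine_dependent U"
    using fin affine_independent_insert[OF V pV] by (auto simp: U_def)
  have aW: "\<not> affine_dependent (insert a W)" "a \<notin> W"
    using affine_independent_insert[OF W a] a hull_inc[of a W affine] by blast+

  obtain g0 where g0: "bij_betw g0 V W"
    using fin card finite_same_card_bij by blast
  \<comment> \<open>The vertices of the facet are matched arbitrarily, and the auxiliary point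
    \<open>p\<close> goes to the apex \<open>a\<close>.\<close>
  define g where "g = g0(p := a)"
  have gp: "g p = a"
    by (simp add: g_def)
  have "bij_betw g V W \<longleftrightarrow> bij_betw g0 V W"
    by (rule bij_betw_cong) (use \<open>p \<notin> V\<close> in \<open>auto simp: g_def\<close>)
  then have gV: "bij_betw g V W"
    using g0 by simp
  then have gU: "bij_betw g U (insert a W)"
    using notIn_Un_bij_betw3[of p V g W] gp \<open>p \<notin> V\<close> \<open>a \<notin> W\<close> by (simp add: U_def)
  have lift: "bij_betw (\<lambda>z. (g (fst z), 1::real)) ((\<lambda>x. (x, 1)) ` U) ((\<lambda>x. (x, 1)) ` insert a W)"
    unfolding bij_betw_def
  proof
    show "inj_on (\<lambda>z. (g (fst z), 1::real)) ((\<lambda>x. (x, 1)) ` U)"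
      using bij_betw_imp_inj_on[OF gU] by (auto simp: inj_on_def)
    show "(\<lambda>z. (g (fst z), 1::real)) ` (\<lambda>x. (x, 1)) ` U = (\<lambda>x. (x, 1)) ` insert a W"
      unfolding bij_betw_imp_surj_on[OF gU, symmetric] by (simp add: image_image)
  qed
  obtain L1 :: "'a \<times> real \<Rightarrow> 'a \<times> real" where L1: "linear L1" "bij L1"
      "\<And>z. z \<in> (\<lambda>x. (x, 1)) ` U \<Longrightarrow> L1 z = (g (fst z), 1)"
    by (rule linear_bij_extend[OF independent_homogenize[OF U(2)] independent_homogenize[OF aW(1)] lift]) blast
  have L1U: "L1 (x, 1) = (g x, 1)" if "x \<in> U" for x
    using L1(3)[of "(x, 1)"] that by simp

  \<comment> \<open>\<open>\<nu>\<close> is the coordinate of \<open>p\<close>; adding a large multiple of \<open>\<nu> z *\<^sub>R s\<close> to \<open>z\<close> makes all coordinates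
    of the vertices of \<open>P\<close> nonnegative and fixes the points of the facet.\<close>
  define \<nu> where "\<nu> z = (b * snd z - n \<bullet> fst z) / (b - n \<bullet> p)" for z
  define s where "s = (\<Sum>v\<in>V. (v, 1::real))"
  have \<nu>_lin: "linear \<nu>"
    unfolding \<nu>_def by (intro linearI) (auto simp: inner_simps algebra_simps add_divide_distrib diff_divide_distrib)
  have \<nu>V: "\<nu> (v, 1) = 0" if "v \<in> V" for v
    using nV[OF that] by (simp add: \<nu>_def)
  have \<nu>p: "\<nu> (p, 1) = 1"
    using np by (simp add: \<nu>_def)
  have \<nu>s: "\<nu> s = 0"
    unfolding s_def by (simp add: linear_sum[OF \<nu>_lin] \<nu>V)
  have \<nu>P: "\<nu> (x, 1) \<ge> 0" "\<nu> (x, 1) = 0 \<longleftrightarrow> x \<in> convex hull V" if "x \<in> P" for x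
    using that n np by (auto simp: \<nu>_def)
  have snd_s: "snd s = card V"
    by (simp add: s_def snd_sum)

  have sumU: "sum h U = h p + sum h V" for h :: "'a \<Rightarrow> 'a \<times> real"
    using fin \<open>p \<notin> V\<close> by (simp add: U_def)
  \<comment> \<open>\<open>U\<close> affinely spans the hull of \<open>P\<close>, since a facet has
    codimension one in \<open>P\<close> and \<open>p\<close> lies off its affine hull.\<close>
  have P_U: "\<exists>u. x = (\<Sum>v\<in>U. u v *\<^sub>R v) \<and> sum u U = 1" if x: "x \<in> P" for x
  proof -
    have "aff_dim U = aff_dim P"
      using F pV by (simp add: U_def aff_dim_insert facet_of_def aff_dim_convex_hull)
    moreover have "U \<subseteq> affine hull P"
      using FP p hull_subset[of V convex] hull_subset[of P affine] by (auto simp: U_def)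
    ultimately have "affine hull U = affine hull P"
      by (rule affine_hull_eq_aff_dim[rotated])
    then have "x \<in> affine hull U"
      using x by (simp add: hull_inc)
    then show ?thesis
      using affine_hull_finite[OF U(1)] by auto
  qed
  \<comment> \<open>On the facet \<nu> vanishes and the coordinates are convex weights. Off the
    facet the coordinate of \<open>p\<close> is \<nu>, which is positive, and every other coordinate
    grows by \<open>M\<close> times this value.\<close>
  have coord: "\<exists>M0. \<forall>M\<ge>M0. \<exists>c. (\<forall>u\<in>U. c u \<ge> 0) \<and>
      (x, 1) + (M * \<nu> (x, 1)) *\<^sub>R s = (\<Sum>u\<in>U. c u *\<^sub>R (u, 1::real))" if x: "x \<in> P" for x
  proof (cases "x \<in> convex hull V")
    case True
    then obtain c where c: "\<forall>v\<in>V. 0 \<le> c v" "sum c V = 1" "(\<Sum>v\<in>V. c v *\<^sub>R v) = x"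
      using fin by (auto simp: convex_hull_finite)
    let ?c = "c(p := 0)"
    have "(\<Sum>v\<in>V. ?c v *\<^sub>R (v, 1::real)) = (\<Sum>v\<in>V. c v *\<^sub>R (v, 1::real))"
      using \<open>p \<notin> V\<close> by (intro sum.cong) auto
    then have "(\<Sum>u\<in>U. ?c u *\<^sub>R (u, 1::real)) = (\<Sum>v\<in>V. c v *\<^sub>R (v, 1::real))"
      unfolding sumU by (simp del: scaleR_Pair)
    also have "\<dots> = (x, 1)"
      using c by (simp add: prod_eq_iff fst_sum snd_sum)
    finally have "(x, 1) + (M * \<nu> (x, 1)) *\<^sub>R s = (\<Sum>u\<in>U. ?c u *\<^sub>R (u, 1::real))" for M
      using \<nu>P[OF x] True by simp
    moreover have "\<forall>u\<in>U. ?c u \<ge> 0"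
      using c by (auto simp: U_def)
    ultimately show ?thesis by blast
  next
    case False
    then have pos: "\<nu> (x, 1) > 0"
      using \<nu>P[OF x] by (simp add: less_le)
    obtain u where u: "x = (\<Sum>v\<in>U. u v *\<^sub>R v)" "sum u U = 1"
      using P_U x by blast
    then have xu: "(x, 1) = (\<Sum>v\<in>U. u v *\<^sub>R (v, 1::real))"
      by (simp add: prod_eq_iff fst_sum snd_sum)
    have "\<nu> (x, 1) = (\<Sum>v\<in>U. u v * \<nu> (v, 1))"
      unfolding xu by (simp only: linear_sum[OF \<nu>_lin] linear_scale[OF \<nu>_lin] real_scaleR_def)
    also have "\<dots> = u p"
      using fin \<open>p \<notin> V\<close> by (simp add: U_def \<nu>p \<nu>V)
    finally have up: "\<nu> (x, 1) = u p" .
    have "\<exists>c. (\<forall>u\<in>U. c u \<ge> 0) \<and> (x, 1) + (M * \<nu> (x, 1)) *\<^sub>R s = (\<Sum>u\<in>U. c u *\<^sub>R (u, 1::real))"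
      if M: "M \<ge> (\<Sum>v\<in>V. \<bar>u v\<bar>) / u p" for M
    proof (intro exI conjI ballI)
      let ?c = "\<lambda>v. if v = p then u p else u v + M * u p"
      have M': "(\<Sum>v\<in>V. \<bar>u v\<bar>) \<le> M * u p"
        using M pos up by (simp add: divide_simps split: if_splits)
      show "?c v \<ge> 0" if "v \<in> U" for v
      proof (cases "v = p")
        case False
        then have "\<bar>u v\<bar> \<le> (\<Sum>v\<in>V. \<bar>u v\<bar>)"
          using fin that by (intro member_le_sum) (auto simp: U_def)
        with False M' show ?thesis by simp
      qed (use pos up in simp)
      have "(\<Sum>v\<in>U. ?c v *\<^sub>R (v, 1::real)) = u p *\<^sub>R (p, 1::real) + (\<Sum>v\<in>V. (u v + M * u p) *\<^sub>R (v, 1::real))"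
      proof -
        have "(\<Sum>v\<in>V. ?c v *\<^sub>R (v, 1::real)) = (\<Sum>v\<in>V. (u v + M * u p) *\<^sub>R (v, 1::real))"
          using \<open>p \<notin> V\<close> by (intro sum.cong) auto
        then show ?thesis
          unfolding sumU by (simp del: scaleR_Pair)
      qed
      also have "\<dots> = (\<Sum>v\<in>U. u v *\<^sub>R (v, 1::real)) + (M * u p) *\<^sub>R s"
        unfolding sumU s_def
        by (simp add: scaleR_add_left sum.distrib scaleR_sum_right del: scaleR_Pair)
      finally show "(x, 1) + (M * \<nu> (x, 1)) *\<^sub>R s = (\<Sum>v\<in>U. ?c v *\<^sub>R (v, 1::real))"
        by (simp only: xu[symmetric] up)
    qed
    then show ?thesis by blast
  qed
  obtain E where E: "finite E" "P = convex hull E"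
    using P by (auto simp: polytope_def)
  have EP: "E \<subseteq> P" using E(2) hull_subset[of E convex] by simp
  have "\<forall>x\<in>E. \<exists>M0. \<forall>M\<ge>M0. \<exists>c. (\<forall>u\<in>U. c u \<ge> 0) \<and>
      (x, 1) + (M * \<nu> (x, 1)) *\<^sub>R s = (\<Sum>u\<in>U. c u *\<^sub>R (u, 1))"
    using coord EP by blast
  from bchoice[OF this] obtain M0 where M0: "\<forall>x\<in>E. \<forall>M\<ge>M0 x. \<exists>c. (\<forall>u\<in>U. c u \<ge> 0) \<and>
      (x, 1) + (M * \<nu> (x, 1)) *\<^sub>R s = (\<Sum>u\<in>U. c u *\<^sub>R (u, 1))"
    by blast
  \<comment> \<open>A single constant above the thresholds of all generators of
    \<open>P\<close>.\<close>
  define M where "M = (\<Sum>x\<in>E. \<bar>M0 x\<bar>)"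
  have M: "M \<ge> 0" "M \<ge> M0 x" if "x \<in> E" for x
  proof -
    have "\<bar>M0 x\<bar> \<le> M"
      unfolding M_def using E that by (intro member_le_sum) auto
    then show "M \<ge> M0 x" by simp
  qed (auto simp: M_def sum_nonneg)

  define L2 where "L2 z = z + (M * \<nu> z) *\<^sub>R s" for z
  define L where "L = L1 \<circ> L2"
  have "linear L2"
    unfolding L2_def
    by (intro linearI) (simp_all add: linear_add[OF \<nu>_lin] linear_scale[OF \<nu>_lin] algebra_simps)
  then have L: "linear L"
    unfolding L_def using L1(1) by (rule linear_compose)
  \<comment> \<open>The shear keeps \<nu>, because \<nu> vanishes on \<open>s\<close>; this makes it
    injective.\<close>
  have \<nu>L2: "\<nu> (L2 z) = \<nu> z" for z
    by (simp add: L2_def linear_add[OF \<nu>_lin] linear_scale[OF \<nu>_lin] \<nu>s)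
  have "inj L2"
  proof (rule injI)
    fix y z assume "L2 y = L2 z"
    moreover from this have "\<nu> y = \<nu> z" using \<nu>L2 by metis
    ultimately show "y = z" by (simp add: L2_def)
  qed
  then have "bij L2"
    using \<open>linear L2\<close> by (simp add: bij_def linear_injective_imp_surjective)
  then have bijL: "bij L"
    unfolding L_def using L1(2) bij_comp by blast

  have vert: "snd (L (x, 1)) > 0 \<and> proj_map L x \<in> convex hull (insert a W)" if x: "x \<in> E" for x
  proof -
    obtain c where c: "\<forall>u\<in>U. c u \<ge> 0" "L2 (x, 1) = (\<Sum>u\<in>U. c u *\<^sub>R (u, 1::real))"
      using M0 x M(2)[OF x] unfolding L2_def by blast
    \<comment> \<open>The last coordinate of the sheared point. Its positivity keeps the point away
      from infinity, and dividing by it turns the coefficients into convex weights.\<close>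
    define C where "C = sum c U"
    have "C = snd (L2 (x, 1))"
      unfolding c(2) C_def by (simp add: snd_sum)
    also have "\<dots> = 1 + M * \<nu> (x, 1) * card V"
      by (simp add: L2_def snd_s)
    finally have C: "C > 0"
      using M(1)[OF x] \<nu>P(1)[of x] x EP by (auto intro!: add_pos_nonneg)
    have "L (x, 1) = (\<Sum>u\<in>U. c u *\<^sub>R L1 (u, 1))"
      unfolding L_def by (simp only: o_apply c(2) linear_sum[OF L1(1)] linear_scale[OF L1(1)])
    also have "\<dots> = (\<Sum>u\<in>U. c u *\<^sub>R (g u, 1::real))"
      using L1U by (simp cong: sum.cong)
    also have "\<dots> = C *\<^sub>R (\<Sum>u\<in>U. (c u / C) *\<^sub>R g u, 1)"
      using C by (simp add: prod_eq_iff fst_sum snd_sum C_def[symmetric] scaleR_sum_right)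
    finally have Lx: "L (x, 1) = C *\<^sub>R (\<Sum>u\<in>U. (c u / C) *\<^sub>R g u, 1)" .
    then have "proj_map L x = (\<Sum>u\<in>U. (c u / C) *\<^sub>R g u)"
      using C by (intro proj_map_unique) auto
    also have "\<dots> \<in> convex hull (insert a W)"
    proof (rule convex_sum[OF U(1) convex_convex_hull])
      show "(\<Sum>u\<in>U. c u / C) = 1"
        using C by (simp add: C_def flip: sum_divide_distrib)
      show "g u \<in> convex hull (insert a W)" if "u \<in> U" for u
        using bij_betwE[OF gU] that by (simp add: hull_inc)
    qed (use c C in auto)
    finally show ?thesis
      using Lx C by simp
  qed
  have "convex {x. snd (L (x, 1)) > 0}"
  proof (rule convexI)
    fix x y and u v :: real
    assume xy: "x \<in> {x. snd (L (x, 1)) > 0}" "y \<in> {x. snd (L (x, 1)) > 0}" "0 \<le> u" "0 \<le> v" "u + v = 1"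
    then have u: "u = 1 - v" by simp
    have "snd (L (u *\<^sub>R x + v *\<^sub>R y, 1)) = u * snd (L (x, 1)) + v * snd (L (y, 1))"
      unfolding u by (simp add: affine_lift_combination[OF L])
    also have "\<dots> > 0"
      using xy by (smt (verit) mem_Collect_eq mult_nonneg_nonneg mult_pos_pos)
    finally show "u *\<^sub>R x + v *\<^sub>R y \<in> {x. snd (L (x, 1)) > 0}" by simp
  qed
  then have "P \<subseteq> {x. snd (L (x, 1)) > 0}"
    unfolding E(2) using vert by (intro hull_minimal) auto
  then have pos: "\<And>x. x \<in> P \<Longrightarrow> snd (L (x, 1)) > 0"
    by blast
  interpret admissible_proj L P
    by (intro admissible_proj.intro L bij_is_inj bijL polytope_imp_convex P pos)
  show ?thesis
  proof (rule that)
    show "projective_transformation L"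
      using L bijL by (simp add: projective_transformation_def)
    \<comment> \<open>The shear fixes the lifted vertices of the facet, so only \<open>L1\<close>
      acts on them.\<close>
    have "proj_map L v = g v" if "v \<in> V" for v
    proof (rule proj_map_unique)
      show "L (v, 1) = 1 *\<^sub>R (g v, 1)"
        using that L1U[of v] by (simp add: L_def L2_def \<nu>V U_def)
    qed simp
    then have "proj_map L ` V = W"
      using gV by (metis bij_betw_def image_cong)
    then show "proj_map L ` (convex hull V) = convex hull W"
      using convex_hull_image[OF FP] by simp
    have "convex hull (proj_map L ` E) \<subseteq> convex hull (insert a W)"
      using vert by (intro hull_minimal) auto
    then show "proj_map L ` P \<subseteq> convex hull (insert a W)"
      using convex_hull_image[of E] by (simp flip: E(2))
  qed (rule pos)
qed

section \<open>Existence and effect of a glueing\<close>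

lemma glueing_exists:
  fixes P Q :: "'a::euclidean_space set"
  assumes P: "polytope P" "aff_dim P = int d" "F facet_of P" "(int d - 1) simplex F"
    and Q: "polytope Q" "aff_dim Q = int d" "F' facet_of Q" "(int d - 1) simplex F'"
  shows "\<exists>L R. glueing d L P F Q F' R"
proof -
  obtain V where V: "\<not> affine_dependent V" "int (card V) = int d" "F = convex hull V"
    using P(4) by (auto simp: simplex_def)
  obtain W where W: "\<not> affine_dependent W" "int (card W) = int d" "F' = convex hull W"
    using Q(4) by (auto simp: simplex_def)
  obtain a where a: "a \<notin> affine hull F'" and cvx: "convex (Q \<union> convex hull (insert a F'))"
    and Int: "Q \<inter> convex hull (insert a F') = F'"
    and ridges: "\<And>G. G face_of F' \<Longrightarrow> G \<noteq> F' \<Longrightarrow> G face_of Q \<union> convex hull (insert a F')"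
    using point_beyond_facet[OF Q(1,3)] by metis
  define T where "T = convex hull (insert a F')"
  have T: "T = convex hull (insert a W)"
    unfolding T_def W(3) by (rule hull_insert[symmetric])
  have aW: "a \<notin> affine hull W" "card V = card W"
    using a V(2) W(2,3) by (simp_all add: affine_hull_convex_hull)
  obtain L where L: "projective_transformation L" "\<And>x. x \<in> P \<Longrightarrow> snd (L (x, 1)) > 0"
    "proj_map L ` F = F'" "proj_map L ` P \<subseteq> T"
    using proj_map_onto_simplex[OF P(1) P(3)[unfolded V(3)] V(1) W(1) aW(2,1)]
    unfolding T V(3) W(3) by metis
  interpret admissible_proj L P
    using L(1) by (intro admissible_proj.intro polytope_imp_convex P(1) L(2))
      (auto simp: projective_transformation_def bij_is_inj)
  let ?P = "proj_map L ` P"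
  have polyP: "polytope ?P"
    using P(1) by (simp add: polytope_image)
  have facet: "F' facet_of ?P"
    using facet_of_image[OF P(3)] L(3) by simp
  have P_Int: "?P \<inter> Q = F'"
    using Int L(4) facet Q(3) facet_of_imp_subset unfolding T_def by blast
  have "convex (?P \<union> Q)"
  proof -
    \<comment> \<open>Convexity of the larger union of the pyramid and \<open>Q\<close> makes the
      segment pass through \<open>F'\<close>; this point splits it into a part in the image of
      \<open>P\<close> and a part in \<open>Q\<close>.\<close>
    have *: "closed_segment x y \<subseteq> ?P \<union> Q" if "x \<in> ?P" "y \<in> Q" for x y
    proof -
      have "closed T"
        unfolding T using aff_independent_finite[OF W(1)]
        by (intro compact_imp_closed finite_imp_compact_convex_hull) simp
      moreover have "closed Q" "convex (T \<union> Q)"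
        using cvx Q(1) by (simp_all add: T_def Un_commute polytope_imp_closed)
      moreover have "x \<in> T"
        using that L(4) by blast
      ultimately obtain z where z: "z \<in> closed_segment x y" "z \<in> T" "z \<in> Q"
        using segment_meets_Int_closed[of T Q x y] \<open>y \<in> Q\<close> by metis
      then have "z \<in> F'"
        using Int by (auto simp: T_def)
      then have "z \<in> ?P"
        using P_Int by blast
      then have "closed_segment x z \<subseteq> ?P" "closed_segment z y \<subseteq> Q"
        using that z(3) polyP Q(1) by (intro closed_segment_subset polytope_imp_convex; simp)+
      then show ?thesis
        using Un_closed_segment[OF z(1)] by blast
    qed
    have "closed_segment x y \<subseteq> ?P \<union> Q" if "x \<in> ?P \<union> Q" "y \<in> ?P \<union> Q" for x y
    proof -
      have "closed_segment x y \<subseteq> ?P" if "x \<in> ?P" "y \<in> ?P"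
        using that polyP by (intro closed_segment_subset polytope_imp_convex)
      moreover have "closed_segment x y \<subseteq> Q" if "x \<in> Q" "y \<in> Q"
        using that Q(1) by (intro closed_segment_subset polytope_imp_convex)
      ultimately show ?thesis
        using that *[of x y] *[of y x] unfolding closed_segment_commute[of y x] by blast
    qed
    then show ?thesis
      by (simp add: convex_contains_segment)
  qed
  \<comment> \<open>A face of the union with the whole pyramid remains a face of the smaller union
    that contains it.\<close>
  moreover have ridges': "G face_of ?P \<union> Q" if "G face_of F'" "G \<noteq> F'" for G
    using face_of_subset[OF ridges[OF that], of "?P \<union> Q"] L(4) face_of_imp_subset[OF that(1)] P_Int
    unfolding T_def by blast
  ultimately interpret facet_union ?P Q
    by unfold_locales (use polyP Q facet P_Int in auto)
  have "\<forall>x\<in>P. \<not> sent_to_infinity L x"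
    using L(2) by (force simp: sent_to_infinity_def)
  then have "glueing d L P F Q F' (?P \<union> Q)"
    unfolding glueing_def using P Q L P_Int polytope_Un ridges' by simp
  then show ?thesis by blast
qed

text \<open>After normalising the sign of \<open>L\<close>, the image of \<open>P\<close> is
  simplicial with the same face numbers, and the image and \<open>Q\<close> satisfy the assumptions
  of \<open>facet_union\<close>.\<close>

lemma glueing_simplicial:
  fixes P Q :: "'a::euclidean_space set"
  assumes d: "d \<ge> 1" and P: "simplicial_polytope d P" and Q: "simplicial_polytope d Q"
    and glue: "glueing d L P F Q F' R"
  shows "simplicial_polytope d R"
    and "f_vector d R = modified_plus d (f_vector d P) (f_vector d Q)"
proof -
  have polyP: "polytope P" and polyQ: "polytope Q" and dP: "aff_dim P = int d"
    using P Q by (auto simp: simplicial_polytope_def)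
  obtain L' where L': "linear L'" "inj L'" "\<And>x. x \<in> P \<Longrightarrow> snd (L' (x, 1)) > 0" "proj_map L' = proj_map L"
    using admissible_projective_transformation_pos[of L P] glue polyP
    by (auto simp: glueing_def polytope_imp_convex)
  interpret admissible_proj L' P
    by (intro admissible_proj.intro L' polytope_imp_convex polyP)
  let ?P = "proj_map L' ` P"
  have g: "F facet_of P" "F' facet_of Q" "proj_map L' ` F = F'" "?P \<inter> Q = F'" "R = ?P \<union> Q"
    "polytope R" "\<And>G. G face_of F' \<Longrightarrow> G \<noteq> F' \<Longrightarrow> G face_of R" "(int d - 1) simplex F'"
    using glue by (auto simp: glueing_def L'(4))
  interpret facet_union ?P Q
    using g polyP polyQ facet_of_image[OF g(1)]
    by unfold_locales (auto simp: polytope_image polytope_imp_convex)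
  show "simplicial_polytope d R"
    unfolding g(5) using simplicial_Un[OF d simplicial_image[OF P] Q] .
  have "f_vector d ?P = f_vector d P"
    by (simp only: f_vector_def card_faces_image)
  then show "f_vector d R = modified_plus d (f_vector d P) (f_vector d Q)"
    using f_vector_Un[OF d] g(4,8) dP by (simp add: g(5) aff_dim_image)
qed

section \<open>From closure under the modified addition to an affine semigroup\<close>

text \<open>Translation by the negative of the correction vector turns the modified addition into
  the ordinary one.\<close>

lemma affine_semigroup_modified_plus:
  assumes "S \<subseteq> int_lattice d" "d \<ge> 1"
    and closed: "\<And>x y. x \<in> S \<Longrightarrow> y \<in> S \<Longrightarrow> modified_plus d x y \<in> S"
  shows "affine_semigroup S (modified_plus d)"
proof -
  let ?\<phi> = "\<lambda>x i. x i - simplex_f_vector_2 d i"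
  have hom: "?\<phi> (modified_plus d x y) = (\<lambda>i. ?\<phi> x i + ?\<phi> y i)" for x y
    by (auto simp: modified_plus_def)
  \<comment> \<open>Here \<open>d \<ge> 1\<close> matters: for \<open>d = 0\<close> the truncated
    \<open>d - 1\<close> is 0, and the entry 2 would fall outside the lattice.\<close>
  have sub: "?\<phi> ` S \<subseteq> int_lattice d"
    using assms(1,2) by (auto simp: int_lattice_def simplex_f_vector_2_def)
  have add: "(\<lambda>i. u i + v i) \<in> ?\<phi> ` S" if uv: "u \<in> ?\<phi> ` S" "v \<in> ?\<phi> ` S" for u v
  proof -
    from uv obtain x y where xy: "x \<in> S" "y \<in> S" "u = ?\<phi> x" "v = ?\<phi> y"
      by blast
    then have "(\<lambda>i. u i + v i) = ?\<phi> (modified_plus d x y)"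
      by (simp only: hom)
    then show ?thesis
      using closed[OF xy(1,2)] by blast
  qed
  have bij: "bij_betw ?\<phi> S (?\<phi> ` S)"
    by (auto simp: bij_betw_def inj_on_def fun_eq_iff)
  show ?thesis
    unfolding affine_semigroup_def
    by (intro conjI ballI exI[of _ d] exI[of _ "?\<phi> ` S"] exI[of _ ?\<phi>] closed sub add bij hom)
qed

theorem corollary5p5:
  fixes d :: nat
  assumes "d \<ge> 2" and "d \<le> DIM('a::euclidean_space)"
  shows "affine_semigroup (simplicial_f_vectors TYPE('a) d) (modified_plus d) \<and>
    (\<forall>P Q F F' :: 'a set.
       simplicial_polytope d P \<and> simplicial_polytope d Q \<and> F facet_of P \<and> F' facet_of Q \<longrightarrow>
         (\<exists>L R. glueing d L P F Q F' R) \<and>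
         (\<forall>L R. glueing d L P F Q F' R \<longrightarrow>
            simplicial_polytope d R \<and>
            f_vector d R = modified_plus d (f_vector d P) (f_vector d Q)))"
proof
  have d: "d \<ge> 1" using assms by simp
  show glue: "\<forall>P Q F F' :: 'a set.
       simplicial_polytope d P \<and> simplicial_polytope d Q \<and> F facet_of P \<and> F' facet_of Q \<longrightarrow>
         (\<exists>L R. glueing d L P F Q F' R) \<and>
         (\<forall>L R. glueing d L P F Q F' R \<longrightarrow>
            simplicial_polytope d R \<and>
            f_vector d R = modified_plus d (f_vector d P) (f_vector d Q))"
  proof (intro allI impI, elim conjE, intro conjI allI impI)
    fix P Q F F' :: "'a set"
    assume PQ: "simplicial_polytope d P" "simplicial_polytope d Q" "F facet_of P" "F' facet_of Q"
    then show "\<exists>L R. glueing d L P F Q F' R"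
      by (intro glueing_exists) (auto simp: simplicial_polytope_def)
    fix L R assume "glueing d L P F Q F' R"
    then show "simplicial_polytope d R" "f_vector d R = modified_plus d (f_vector d P) (f_vector d Q)"
      using glueing_simplicial[OF d PQ(1,2)] by blast+
  qed
  show "affine_semigroup (simplicial_f_vectors TYPE('a) d) (modified_plus d)"
  proof (rule affine_semigroup_modified_plus[OF simplicial_f_vectors_subset d])
    fix x y assume "x \<in> simplicial_f_vectors TYPE('a) d" "y \<in> simplicial_f_vectors TYPE('a) d"
    then obtain P Q :: "'a set" where P: "x = f_vector d P" "simplicial_polytope d P"
      and Q: "y = f_vector d Q" "simplicial_polytope d Q"
      by (auto simp: simplicial_f_vectors_def)
    \<comment> \<open>Positive dimension provides a facet of each polytope, and glueing along these
      facets yields a polytope that realises the modified sum.\<close>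
    have "aff_dim P > 0" "aff_dim Q > 0"
      using P Q d by (auto simp: simplicial_polytope_def)
    then obtain F F' where "F facet_of P" "F' facet_of Q"
      using P Q polytope_facet_exists by (metis simplicial_polytope_def)
    then obtain L R where R: "glueing d L P F Q F' R"
      using glue P(2) Q(2) by blast
    show "modified_plus d x y \<in> simplicial_f_vectors TYPE('a) d"
      using glueing_simplicial[OF d P(2) Q(2) R] unfolding P(1) Q(1) simplicial_f_vectors_def
      by (intro CollectI exI[of _ R]) simp
  qed
qed

end
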